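(* Let $n$ be an even positive integer and let $M$ be a combinatorial $3$-manifold with $n$ vertices given as a union of pairwise distinct difference cycles $$M=\left\{ d_1,\ldots,d_m,\left(1:\tfrac n2-1:1:\tfrac n2-1\right)\right\},$$ where $d_i=(d_i^0:d_i^1:d_i^2:d_i^3)$, $d_i^0+d_i^1+d_i^2+d_i^3=n$, and each $d_i$ is written (after cyclic rotation of its entries) such that $d_i^3\ge d_i^j$ for all $0\le j\le 2$. For $k\ge 0$ let $d_{i,k}=(d_i^0:d_i^1:d_i^2:d_i^3+k)$ and let $M_k$ be the simplicial complex on $n+k$ vertices $$M_k=\{d_{1,k},\ldots,d_{m,k}\}\cup\bigcup_{\ell=n/2}^{\lfloor (n+k)/2\rfloor}\{(1:\ell-1:1:n+k-\ell-1)\}.$$ Then $M_k$ is a combinatorial $3$-manifold for all $k\ge 0$ if and only if each difference cycle $d_i$, $1\le i\le m$, contains an entry greater than or equal to $n/2$ (equivalently, $d_i^0+d_i^1+d_i^2\le n/2$ for all $1\le i\le m$). Moreover, in this case, for every $k\ge 0$, $M$ is neighbourly if and only if $M_k$ is neighbourly.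
   Context: For positive integers $a_0,\ldots,a_d$ with $n=\sum_{i=0}^d a_i$, the difference cycle $(a_0:\ldots:a_d)$ is the collection of $d$-simplices $\{x,\,x+a_0,\,x+a_0+a_1,\ldots,x+a_0+\cdots+a_{d-1}\}$, $x\in\mathbb Z_n$, on the vertex set $\mathbb Z_n$; that is, the orbit of $\langle 0,a_0,\ldots,a_0+\cdots+a_{d-1}\rangle$ under $\mathbb Z_n$ acting by $v\mapsto v+1 \bmod n$. It is unchanged by cyclic rotation of the entries. A set of difference cycles stands for the simplicial complex whose facets are all simplices in their union. A combinatorial $3$-manifold is a pure $3$-dimensional abstract simplicial complex in which every vertex link is a triangulated $2$-sphere. It is neighbourly if it contains all $\binom{N}{2}$ edges, where $N$ is its number of vertices. *)

theory Defs
  imports "HOL-Analysis.Analysis"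
begin

text \<open>Abstract simplicial complexes are finite and do not contain the empty simplex.\<close>

definition simplicial_cplx :: "'a set set \<Rightarrow> bool" where
  "simplicial_cplx K \<longleftrightarrow> finite K \<and>
     (\<forall>s\<in>K. finite s \<and> s \<noteq> {} \<and> (\<forall>t. t \<subseteq> s \<and> t \<noteq> {} \<longrightarrow> t \<in> K))"

abbreviation cplx_vertices :: "'a set set \<Rightarrow> 'a set" where
  "cplx_vertices K \<equiv> \<Union>K"

definition cplx_facets :: "'a set set \<Rightarrow> 'a set set" where
  "cplx_facets K = {s \<in> K. \<forall>t\<in>K. s \<subseteq> t \<longrightarrow> t = s}"

definition pure_cplx :: "nat \<Rightarrow> 'a set set \<Rightarrow> bool" where
  "pure_cplx d K \<longleftrightarrow> K \<noteq> {} \<and> (\<forall>s\<in>cplx_facets K. card s = d + 1)"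

definition cplx_link :: "'a set set \<Rightarrow> 'a \<Rightarrow> 'a set set" where
  "cplx_link K v = {s \<in> K. v \<notin> s \<and> insert v s \<in> K}"

text \<open>Barycentric coordinates. The function space carries the product topology, which on the
  realization of a finite complex is the usual topology.\<close>

definition geom_realization :: "'a set set \<Rightarrow> ('a \<Rightarrow> real) set" where
  "geom_realization K =
     {f. (\<forall>v. 0 \<le> f v) \<and> {v. f v \<noteq> 0} \<in> K \<and> (\<Sum>v | f v \<noteq> 0. f v) = 1}"

definition triangulated_2_sphere :: "'a set set \<Rightarrow> bool" where
  "triangulated_2_sphere K \<longleftrightarrow>
     simplicial_cplx K \<and> geom_realization K homeomorphic (sphere 0 1 :: (real ^ 3) set)"

definition combinatorial_3_manifold :: "'a set set \<Rightarrow> bool" where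
  "combinatorial_3_manifold K \<longleftrightarrow>
     simplicial_cplx K \<and> pure_cplx 3 K \<and>
     (\<forall>v\<in>cplx_vertices K. triangulated_2_sphere (cplx_link K v))"

definition neighbourly :: "'a set set \<Rightarrow> bool" where
  "neighbourly K \<longleftrightarrow>
     (\<forall>u\<in>cplx_vertices K. \<forall>v\<in>cplx_vertices K. u \<noteq> v \<longrightarrow> {u, v} \<in> K)"

text \<open>The difference cycle $(a_0 : \ldots : a_d)$, given by the list of its entries; the
  residues modulo $n = a_0 + \cdots + a_d$ are represented by the numbers below $n$.\<close>

definition diff_cycle :: "nat list \<Rightarrow> nat set set" where
  "diff_cycle a =
     {{(x + sum_list (take i a)) mod sum_list a | i. i < length a} | x. x < sum_list a}"

definition diff_cplx :: "nat list set \<Rightarrow> nat set set" where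
  "diff_cplx A = {s. s \<noteq> {} \<and> (\<exists>t \<in> \<Union>(diff_cycle ` A). s \<subseteq> t)}"

text \<open>\<open>d i j\<close> is the entry $d_i^j$, for \<open>1 \<le> i \<le> m\<close> and \<open>j \<le> 3\<close>.\<close>

definition ext_cycle :: "(nat \<Rightarrow> nat \<Rightarrow> nat) \<Rightarrow> nat \<Rightarrow> nat \<Rightarrow> nat list" where
  "ext_cycle d k i = [d i 0, d i 1, d i 2, d i 3 + k]"

definition ext_cplx :: "nat \<Rightarrow> nat \<Rightarrow> (nat \<Rightarrow> nat \<Rightarrow> nat) \<Rightarrow> nat \<Rightarrow> nat set set" where
  "ext_cplx n m d k =
     diff_cplx (ext_cycle d k ` {1..m} \<union>
       {[1, l - 1, 1, n + k - l - 1] | l. n div 2 \<le> l \<and> l \<le> (n + k) div 2})"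

end

theory Submission
  imports Defs
begin

text \<open>By cyclic symmetry all vertex links of \<open>M\<^sub>k\<close> are isomorphic to one complex, whose vertices can be
  taken to be the integers from \<open>-h\<close> to \<open>h + k - 1\<close>, where \<open>h = n/2\<close>. If all \<open>d\<^sub>i\<close> satisfy
  \<open>d\<^sub>i\<^sup>0 + d\<^sub>i\<^sup>1 + d\<^sub>i\<^sup>2 \<le> h\<close>, their contribution does not depend on \<open>k\<close>, except that \<open>h\<close> and \<open>-h\<close> coincide
  for \<open>k = 0\<close>. Passing from \<open>k = 0\<close> to \<open>k = 1\<close> splits this vertex into the edge \<open>{h, -h}\<close>, and every
  further step subdivides the edge \<open>{h + k - 1, -h}\<close>; both are sequences of bistellar moves and preserve
  the realization. That the split takes place along a path of the link uses that in a triangulated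
  sphere every edge lies in two triangles and vertex links are connected (invariance of domain).
  Conversely, if \<open>s = d\<^sub>i\<^sup>0 + d\<^sub>i\<^sup>1 + d\<^sub>i\<^sup>2 > h\<close>, then in \<open>M\<^sub>n\<close> the link of the edge \<open>{0, s}\<close> contains the
  4-cycle \<open>1, s + 1, -1, s - 1\<close>, hence nothing else, which forces \<open>d\<^sub>i = (1 : h - 1 : 1 : h - 1)\<close>.\<close>

section \<open>Bistellar moves\<close>

text \<open>Sphericity is defined through realizations, so every change of a link needs an explicit
  homeomorphism, and combinatorial facts about spheres have to be extracted from topology: removing
  one point leaves a plane, where invariance of domain applies. The delicate passage is from
  \<open>k = 0\<close> to \<open>k = 1\<close>. Nothing in the entries of the cycles shows that the
  triangles belonging to \<open>h\<close> form a disc around it; this has to come from the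
  hypothesis on \<open>M\<close>. There the link of the merged vertex is a circle, the triangles of
  \<open>h\<close> use only positive neighbours and \<open>-1\<close>, those of \<open>-h\<close>
  only negative ones and \<open>1\<close>, and so the circle changes sides only at \<open>1\<close>
  and \<open>-1\<close>. The converse is tested at \<open>k = n\<close> because \<open>s + 1\<close>
  is at most \<open>n\<close>, so that all triangles around \<open>s\<close> are found without
  reduction modulo \<open>2 n\<close>. The cycle forced there is excluded because the given cycles
  are distinct. For neighbourliness, the fan supplies every neighbour of \<open>0\<close> except
  those at distance \<open>2\<close> to \<open>h - 2\<close>, and the latter can only come from the
  \<open>d_i\<close>, whatever \<open>k\<close> is.\<close>

definition faces :: "'a set set \<Rightarrow> 'a set set" where
  "faces F = {s. s \<noteq> {} \<and> (\<exists>t\<in>F. s \<subseteq> t)}"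

lemma diff_cplx_eq_faces: "diff_cplx A = faces (\<Union>(diff_cycle ` A))"
  by (simp add: diff_cplx_def faces_def)

text \<open>Replacing the support by any facet containing it turns the normalisation into a sum over
  a fixed set, which is linear in \<open>f\<close>. The support is nonempty, as a simplex must be,
  because the coordinates sum to 1.\<close>

lemma geom_realization_faces:
  assumes "\<And>t. t \<in> F \<Longrightarrow> finite t"
  shows "geom_realization (faces F) =
    {f. (\<forall>v. 0 \<le> f v) \<and> (\<exists>t\<in>F. (\<forall>v. v \<notin> t \<longrightarrow> f v = 0) \<and> sum f t = 1)}"
proof -
  have eq: "(\<Sum>v | f v \<noteq> 0. f v) = sum f t"
    if "t \<in> F" "{v. f v \<noteq> 0} \<subseteq> t" for f :: "'a \<Rightarrow> real" and t
    by (rule sum.mono_neutral_left) (use that assms in auto)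
  have ne: "{v. f v \<noteq> 0} \<noteq> {}" if "sum f t = 1" for f :: "'a \<Rightarrow> real" and t
  proof
    assume "{v. f v \<noteq> 0} = {}"
    then have "f v = 0" for v by auto
    with that show False by simp
  qed
  show ?thesis
  proof (intro set_eqI iffI)
    fix f :: "'a \<Rightarrow> real" assume f: "f \<in> geom_realization (faces F)"
    then obtain t where t: "t \<in> F" "{v. f v \<noteq> 0} \<subseteq> t"
      by (auto simp: geom_realization_def faces_def)
    have "sum f t = 1" using f eq[OF t] by (simp add: geom_realization_def)
    moreover have "f v = 0" if "v \<notin> t" for v using t that by blast
    ultimately show "f \<in> {f. (\<forall>v. 0 \<le> f v) \<and> (\<exists>t\<in>F. (\<forall>v. v \<notin> t \<longrightarrow> f v = 0) \<and> sum f t = 1)}"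
      using f t(1) by (auto simp: geom_realization_def)
  next
    fix f :: "'a \<Rightarrow> real"
    assume "f \<in> {f. (\<forall>v. 0 \<le> f v) \<and> (\<exists>t\<in>F. (\<forall>v. v \<notin> t \<longrightarrow> f v = 0) \<and> sum f t = 1)}"
    then obtain t where t: "t \<in> F" "\<forall>v. v \<notin> t \<longrightarrow> f v = 0" "sum f t = 1" and f0: "\<forall>v. 0 \<le> f v"
      by auto
    have "{v. f v \<noteq> 0} \<subseteq> t" using t(2) by auto
    then show "f \<in> geom_realization (faces F)"
      using eq[OF t(1), of f] t ne[OF t(3)] f0 unfolding geom_realization_def faces_def
      by auto
  qed
qed

lemma sum_eq_on_supersets:
  fixes f :: "'a \<Rightarrow> real"
  assumes "finite t" "finite u" "\<And>v. v \<notin> t \<Longrightarrow> f v = 0" "\<And>v. v \<notin> u \<Longrightarrow> f v = 0"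
  shows "sum f t = sum f u"
  by (rule sum.mono_neutral_cong) (use assms in auto)

lemma continuous_on_coordinate: "continuous_on X (\<lambda>f. f x)"
  by (rule continuous_on_product_then_coordinatewise) (rule continuous_on_id)

lemma continuous_on_Min_coordinates:
  fixes S :: "'a set"
  assumes "finite S" "S \<noteq> {}"
  shows "continuous_on X (\<lambda>f :: 'a \<Rightarrow> real. Min (f ` S))"
  using assms
proof (induction S rule: finite_ne_induct)
  case (singleton x)
  then show ?case by (simp add: continuous_on_coordinate)
next
  case (insert x S)
  then have "(\<lambda>f :: 'a \<Rightarrow> real. Min (f ` insert x S)) = (\<lambda>f. min (f x) (Min (f ` S)))"
    by auto
  then show ?case
    using insert by (simp add: continuous_on_min continuous_on_coordinate)
qed

text \<open>Coordinatewise description of a bistellar move: the common minimum of the coordinates in \<open>S\<close>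
  is moved to the coordinates in \<open>T\<close>.\<close>

definition mass_transfer :: "'a set \<Rightarrow> 'a set \<Rightarrow> ('a \<Rightarrow> real) \<Rightarrow> 'a \<Rightarrow> real" where
  "mass_transfer S T f = (\<lambda>x. f x - (if x \<in> S then Min (f ` S) else 0)
      + (if x \<in> T then real (card S) / real (card T) * Min (f ` S) else 0))"

lemma continuous_on_mass_transfer:
  assumes "finite S" "S \<noteq> {}"
  shows "continuous_on X (mass_transfer S T)"
proof (rule continuous_on_coordinatewise_then_product)
  fix x
  define c where "c = real (card S) / real (card T)"
  show "continuous_on X (\<lambda>f. mass_transfer S T f x)"
    unfolding mass_transfer_def c_def[symmetric]
    using continuous_on_Min_coordinates[OF assms, of X]
    by (cases "x \<in> S"; cases "x \<in> T")
       (auto intro!: continuous_on_add continuous_on_diff continuous_on_mult_left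
          continuous_on_coordinate)
qed

text \<open>One half of a bistellar move, stated on facets: a facet containing \<open>S\<close> may
  trade any one vertex of \<open>S\<close> for all of \<open>T\<close>, as when \<open>S\<close>
  joined with the boundary of \<open>T\<close> gives way to the boundary of \<open>S\<close> joined
  with \<open>T\<close>. Demanding this in both directions takes the place of the usual condition on
  the link of \<open>S\<close>.\<close>

definition bistellar_compatible :: "'a set \<Rightarrow> 'a set \<Rightarrow> 'a set set \<Rightarrow> 'a set set \<Rightarrow> bool" where
  "bistellar_compatible S T F F' \<longleftrightarrow> (\<forall>t\<in>F. finite t \<and> \<not> T \<subseteq> t \<and>
     (if S \<subseteq> t then \<forall>r\<in>S. \<exists>t'\<in>F'. (t - {r}) \<union> T \<subseteq> t' else \<exists>t'\<in>F'. t \<subseteq> t'))"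

lemma bistellar_compatibleI:
  assumes "\<And>t. t \<in> F \<Longrightarrow> finite t" "\<And>t. t \<in> F \<Longrightarrow> \<not> T \<subseteq> t"
    "\<And>t r. t \<in> F \<Longrightarrow> S \<subseteq> t \<Longrightarrow> r \<in> S \<Longrightarrow> \<exists>t'\<in>F'. (t - {r}) \<union> T \<subseteq> t'"
    "\<And>t. t \<in> F \<Longrightarrow> \<not> S \<subseteq> t \<Longrightarrow> \<exists>t'\<in>F'. t \<subseteq> t'"
  shows "bistellar_compatible S T F F'"
  using assms unfolding bistellar_compatible_def by auto

text \<open>Subtracting the minimum over \<open>S\<close> kills the coordinate of some
  \<open>r\<close> in \<open>S\<close>, so the new support fits into a facet obtained by trading
  \<open>r\<close> for \<open>T\<close>; the factor \<open>card S / card T\<close> preserves the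
  total mass. Since \<open>T\<close> was not contained in the old facet, the minimum over
  \<open>T\<close> was 0 before, hence afterwards it is exactly the amount added, and the opposite
  transfer undoes the map.\<close>

lemma mass_transfer_into:
  assumes ST: "finite S" "S \<noteq> {}" "finite T" "T \<noteq> {}" "S \<inter> T = {}"
    and comp: "bistellar_compatible S T F F'" and fin': "\<And>t. t \<in> F' \<Longrightarrow> finite t"
    and f: "f \<in> geom_realization (faces F)"
  shows "mass_transfer S T f \<in> geom_realization (faces F')"
    and "mass_transfer T S (mass_transfer S T f) = f"
proof -
  have fin: "\<And>t. t \<in> F \<Longrightarrow> finite t" using comp by (auto simp: bistellar_compatible_def)
  define m where "m = Min (f ` S)"
  define g where "g = mass_transfer S T f"
  define c where "c = real (card S) / real (card T)"
  have g: "g x = f x - (if x \<in> S then m else 0) + (if x \<in> T then c * m else 0)" for x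
    by (simp add: g_def mass_transfer_def m_def c_def)
  have f0: "0 \<le> f v" for v
    using f fin by (auto simp: geom_realization_faces)
  from f obtain t where t: "t \<in> F" and out: "\<And>v. v \<notin> t \<Longrightarrow> f v = 0" and s1: "sum f t = 1"
    using fin by (auto simp: geom_realization_faces)
  have m0: "0 \<le> m" unfolding m_def using ST f0 by (subst Min_ge_iff) auto
  have mle: "m \<le> f x" if "x \<in> S" for x
    unfolding m_def using that ST by auto
  obtain r where r: "r \<in> S" "f r = m"
    using Min_in[of "f ` S"] ST unfolding m_def by fastforce
  have c0: "c \<ge> 0" "c * card T = card S" "c > 0"
    using ST unfolding c_def by (auto simp: card_gt_0_iff)
  have g0: "0 \<le> g v" for v
    unfolding g using mle[of v] f0[of v] m0 c0 by auto
  obtain x0 where x0: "x0 \<in> T" "x0 \<notin> t" using comp t by (auto simp: bistellar_compatible_def)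
  have MinT: "Min (f ` T) = 0"
    using ST x0 out[of x0] f0 by (intro Min_eqI) (auto simp: image_iff intro!: bexI[of _ x0])
  have "\<exists>t'\<in>F'. (\<forall>v. v \<notin> t' \<longrightarrow> g v = 0) \<and> sum g t' = 1"
  proof (cases "S \<subseteq> t")
    case False
    \<comment> \<open>Off the faces containing \<open>S\<close> the minimum vanishes and the
      transfer is the identity.\<close>
    then obtain x where "x \<in> S" "x \<notin> t" by auto
    then have "m = 0" using out[of x] mle[of x] m0 by auto
    then have gf: "g = f" by (auto simp: g)
    obtain t' where t': "t' \<in> F'" "t \<subseteq> t'"
      using comp t False unfolding bistellar_compatible_def by meson
    then have "sum f t' = sum f t" using out fin' fin t
      by (intro sum_eq_on_supersets) auto
    then show ?thesis using t' s1 gf out by (intro bexI[of _ t']) auto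
  next
    case True
    then obtain t' where t': "t' \<in> F'" "(t - {r}) \<union> T \<subseteq> t'"
      using comp t r unfolding bistellar_compatible_def by meson
    have gout: "g v = 0" if "v \<notin> t'" for v
      using that t' r out[of v] True ST unfolding g by (cases "v = r") auto
    \<comment> \<open>A common finite superset, over which the sums of \<open>f\<close> and
      \<open>g\<close> can be compared term by term.\<close>
    define U where "U = t \<union> T \<union> t'"
    have finU: "finite U" unfolding U_def using fin t fin' t' ST by auto
    have sU: "S \<subseteq> U" "T \<subseteq> U" using True unfolding U_def by auto
    have "sum g t' = sum g U"
      by (rule sum_eq_on_supersets) (use fin' t' finU gout in \<open>auto simp: U_def\<close>)
    also have "\<dots> = sum f U - (\<Sum>x\<in>U. if x \<in> S then m else 0) + (\<Sum>x\<in>U. if x \<in> T then c * m else 0)"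
      unfolding g by (simp add: sum.distrib sum_subtractf)
    also have "(\<Sum>x\<in>U. if x \<in> S then m else 0) = card S * m"
      using finU sU by (simp add: sum.If_cases Int_absorb1)
    also have "(\<Sum>x\<in>U. if x \<in> T then c * m else 0) = card T * (c * m)"
      using finU sU by (simp add: sum.If_cases Int_absorb1)
    also have "card T * (c * m) = card S * m" using c0 by (metis mult.assoc mult.commute)
    also have "sum f U = sum f t"
      by (rule sum_eq_on_supersets) (use fin t finU out in \<open>auto simp: U_def\<close>)
    finally show ?thesis using t' gout s1 by auto
  qed
  then show "mass_transfer S T f \<in> geom_realization (faces F')"
    using g0 fin' unfolding g_def[symmetric] by (simp add: geom_realization_faces)
  have "Min (g ` T) = c * m"
  proof (rule Min_eqI)
    show "c * m \<in> g ` T"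
      using x0 out[of x0] ST by (auto simp: g image_iff intro!: bexI[of _ x0])
    show "c * m \<le> y" if "y \<in> g ` T" for y
    proof -
      obtain x where x: "x \<in> T" "y = g x" using \<open>y \<in> g ` T\<close> by auto
      then have "x \<notin> S" using ST(5) by auto
      then show ?thesis using x f0[of x] by (simp add: g)
    qed
  qed (use ST in auto)
  then have "mass_transfer T S g x =
      g x - (if x \<in> T then c * m else 0) + (if x \<in> S then real (card T) / real (card S) * (c * m) else 0)" for x
    by (simp add: mass_transfer_def)
  moreover have "real (card T) / real (card S) * (c * m) = m"
    using ST unfolding c_def by (auto simp: card_gt_0_iff field_simps)
  ultimately show "mass_transfer T S (mass_transfer S T f) = f"
    unfolding g_def[symmetric] using ST by (auto simp: g fun_eq_iff)
qed

theorem homeomorphic_bistellar: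
  assumes ST: "finite S" "S \<noteq> {}" "finite T" "T \<noteq> {}" "S \<inter> T = {}"
    and comp: "bistellar_compatible S T F F'" "bistellar_compatible T S F' F"
  shows "geom_realization (faces F) homeomorphic geom_realization (faces F')"
proof -
  have fin: "\<And>t. t \<in> F \<Longrightarrow> finite t" "\<And>t. t \<in> F' \<Longrightarrow> finite t"
    using comp by (auto simp: bistellar_compatible_def)
  have TS: "T \<inter> S = {}" using ST by auto
  note a = mass_transfer_into[OF ST comp(1) fin(2)]
  note b = mass_transfer_into[OF ST(3,4,1,2) TS comp(2) fin(1)]
  show ?thesis
    unfolding homeomorphic_minimal
    by (rule exI[of _ "mass_transfer S T"], rule exI[of _ "mass_transfer T S"])
       (use a b continuous_on_mass_transfer[OF ST(1,2)] continuous_on_mass_transfer[OF ST(3,4)] in auto)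
qed

text \<open>Coordinates are transported along \<open>p\<close> and filled up with 0 outside the
  vertices, since points are functions on the whole type. This transfers results from the integer
  model of a link to the links in the residues.\<close>

lemma homeomorphic_relabel:
  fixes F :: "'a set set" and p :: "'a \<Rightarrow> 'b"
  assumes fin: "\<And>t. t \<in> F \<Longrightarrow> finite t" and inj: "inj_on p (\<Union>F)"
  shows "geom_realization (faces F) homeomorphic geom_realization (faces ((`) p ` F))"
proof -
  define V where "V = \<Union>F"
  define push where "push f y = (if y \<in> p ` V then f (inv_into V p y) else 0)" for f :: "'a \<Rightarrow> real" and y
  define pull where "pull g x = (if x \<in> V then g (p x) else 0)" for g :: "'b \<Rightarrow> real" and x
  have inj: "inj_on p V" using inj by (simp add: V_def)
  have inv: "inv_into V p (p x) = x" if "x \<in> V" for x using inj that by simp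
  have push_p: "push f (p x) = f x" if "x \<in> V" for f x
    using that inv by (simp add: push_def)
  have fin': "\<And>t. t \<in> (`) p ` F \<Longrightarrow> finite t" using fin by auto
  have sub: "t \<subseteq> V" if "t \<in> F" for t using that by (auto simp: V_def)
  have injt: "inj_on p t" if "t \<in> F" for t using inj sub[OF that] by (rule inj_on_subset)
  have cpush: "continuous_on X push" for X
    apply (rule continuous_on_coordinatewise_then_product)
    unfolding push_def
    subgoal for y by (cases "y \<in> p ` V") (simp_all add: continuous_on_coordinate)
    done
  have cpull: "continuous_on X pull" for X
    apply (rule continuous_on_coordinatewise_then_product)
    unfolding pull_def
    subgoal for x by (cases "x \<in> V") (simp_all add: continuous_on_coordinate)
    done
  have 1: "push f \<in> geom_realization (faces ((`) p ` F)) \<and> pull (push f) = f"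
    if f: "f \<in> geom_realization (faces F)" for f
  proof -
    obtain t where t: "t \<in> F" and out: "\<And>v. v \<notin> t \<Longrightarrow> f v = 0" and s1: "sum f t = 1"
      and f0: "\<And>v. 0 \<le> f v"
      using f fin by (auto simp: geom_realization_faces)
    have "sum (push f) (p ` t) = (\<Sum>x\<in>t. push f (p x))"
      using sum.reindex[OF injt[OF t]] by (simp add: o_def)
    also have "\<dots> = sum f t" using push_p sub[OF t] by (intro sum.cong) auto
    finally have "sum (push f) (p ` t) = 1" using s1 by simp
    moreover have "push f v = 0" if "v \<notin> p ` t" for v
    proof (cases "v \<in> p ` V")
      case True
      then obtain x where x: "x \<in> V" "v = p x" by auto
      then have "x \<notin> t" using that by auto
      then show ?thesis using x out push_p by simp
    qed (simp add: push_def)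
    moreover have "0 \<le> push f v" for v using f0 by (simp add: push_def)
    moreover have "pull (push f) = f"
      using push_p out sub[OF t] by (auto simp: pull_def fun_eq_iff)
    ultimately show ?thesis using t fin' by (auto simp: geom_realization_faces)
  qed
  have 2: "pull g \<in> geom_realization (faces F) \<and> push (pull g) = g"
    if g: "g \<in> geom_realization (faces ((`) p ` F))" for g
  proof -
    obtain t where t: "t \<in> F" and out: "\<And>v. v \<notin> p ` t \<Longrightarrow> g v = 0" and s1: "sum g (p ` t) = 1"
      and g0: "\<And>v. 0 \<le> g v"
      using g fin' by (auto simp: geom_realization_faces)
    have "sum g (p ` t) = (\<Sum>x\<in>t. g (p x))"
      using sum.reindex[OF injt[OF t]] by (simp add: o_def)
    also have "\<dots> = sum (pull g) t" using sub[OF t] by (intro sum.cong) (auto simp: pull_def)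
    finally have "sum (pull g) t = 1" using s1 by simp
    moreover have "pull g v = 0" if "v \<notin> t" for v
      using that out sub[OF t] inj by (auto simp: pull_def inj_on_def image_iff)
    moreover have "0 \<le> pull g v" for v using g0 by (simp add: pull_def)
    moreover have "push (pull g) = g"
    proof
      fix y
      show "push (pull g) y = g y"
      proof (cases "y \<in> p ` V")
        case True
        then show ?thesis using push_p by (auto simp: pull_def)
      next
        case False
        then show ?thesis using out[of y] sub[OF t] by (auto simp: push_def)
      qed
    qed
    ultimately show ?thesis using t fin by (auto simp: geom_realization_faces)
  qed
  show ?thesis
    unfolding homeomorphic_minimal
    by (rule exI[of _ push], rule exI[of _ pull]) (use 1 2 cpush cpull in auto)
qed

text \<open>Splitting the vertex \<open>w\<close> along the path \<open>b 0, \<dots>, b r\<close> of its link: the new vertex \<open>v\<close> is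
  introduced in the first triangle of the fan, and each further triangle of the fan is moved
  from \<open>w\<close> to \<open>v\<close> by one flip.\<close>

lemma homeomorphic_vertex_split:
  fixes b :: "nat \<Rightarrow> 'a"
  assumes r: "r \<ge> 2" and inj: "inj_on b {..r}"
    and w: "w \<notin> b ` {..r}" and v: "v \<notin> b ` {..r}" "v \<noteq> w"
    and R: "\<And>t. t \<in> R \<Longrightarrow> finite t \<and> v \<notin> t"
    and Rw: "\<And>t i. t \<in> R \<Longrightarrow> w \<in> t \<Longrightarrow> 0 < i \<Longrightarrow> i < r \<Longrightarrow> b i \<notin> t"
  shows "geom_realization (faces (R \<union> {{w, b i, b (Suc i)} | i. i < r})) homeomorphic
     geom_realization (faces (R \<union> {{v, b i, b (Suc i)} | i. i < r} \<union> {{v, w, b 0}, {v, w, b r}}))"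
proof -
  \<comment> \<open>The intermediate complex in which \<open>v\<close> has taken over the first
    \<open>j\<close> triangles of the fan; the triangles \<open>{v, w, b 0}\<close> and
    \<open>{v, w, b j}\<close> fill the gap between \<open>v\<close> and \<open>w\<close>.\<close>
  define F where "F j = R \<union> {{w, b i, b (Suc i)} | i. j \<le> i \<and> i < r} \<union> {{v, b i, b (Suc i)} | i. i < j}
     \<union> {{v, w, b 0}, {v, w, b j}}" for j
  have beq: "b i = b j \<longleftrightarrow> i = j" if "i \<le> r" "j \<le> r" for i j
    using inj that by (auto dest: inj_onD)
  have wb: "w \<noteq> b i" "b i \<noteq> w" "v \<noteq> b i" "b i \<noteq> v" if "i \<le> r" for i
    using w v that by auto
  have mem: "b k \<in> {x, b i, b (Suc i)} \<longleftrightarrow> k = i \<or> k = Suc i" if "i < r" "x = v \<or> x = w" "k \<le> r" for i x k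
    using that beq[of k i] beq[of k "Suc i"] wb[of k] by auto
  have mem_v: "v \<notin> {w, b i, b (Suc i)}" and mem_w: "w \<notin> {v, b i, b (Suc i)}" if "i < r" for i
    using wb[of i] wb[of "Suc i"] v that by auto
  \<comment> \<open>In the quadrilateral formed by \<open>{v, w, b j}\<close> and
    \<open>{w, b j, b (Suc j)}\<close> the diagonal \<open>{w, b j}\<close> is exchanged for
    \<open>{v, b (Suc j)}\<close>. As \<open>b j\<close> is interior to the path, \<open>Rw\<close>
    keeps triangles of \<open>R\<close> away from the old diagonal.\<close>
  have flip: "geom_realization (faces (F j)) homeomorphic geom_realization (faces (F (Suc j)))"
    if j: "1 \<le> j" "j < r" for j
  proof (rule homeomorphic_bistellar)
    note [simp] = beq wb R
    show "{w, b j} \<inter> {v, b (Suc j)} = {}" using j v by auto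
    show "bistellar_compatible {w, b j} {v, b (Suc j)} (F j) (F (Suc j))"
    proof (rule bistellar_compatibleI)
      fix t assume t: "t \<in> F j"
      show "finite t" using t R by (auto simp: F_def)
      show "\<not> {v, b (Suc j)} \<subseteq> t" using t R j v by (auto simp: F_def)
      show "\<exists>t'\<in>F (Suc j). t \<subseteq> t'" if n: "\<not> {w, b j} \<subseteq> t"
      proof -
        have "t \<in> R \<or> (\<exists>i. j \<le> i \<and> i < r \<and> t = {w, b i, b (Suc i)}) \<or>
           (\<exists>i. i < j \<and> t = {v, b i, b (Suc i)}) \<or> t = {v, w, b 0}"
          using t n by (auto simp: F_def)
        moreover have "i \<noteq> j" if "t = {w, b i, b (Suc i)}" for i
          using that n by auto
        ultimately consider "t \<in> R" | i where "j \<le> i" "i < r" "i \<noteq> j" "t = {w, b i, b (Suc i)}"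
          | i where "i < j" "t = {v, b i, b (Suc i)}" | "t = {v, w, b 0}"
          by blast
        then have "t \<in> F (Suc j)"
        proof cases
          case 2
          then have "Suc j \<le> i" by simp
          then show ?thesis using 2 unfolding F_def by blast
        next
          case 3
          then have "i < Suc j" by simp
          then show ?thesis using 3 unfolding F_def by blast
        qed (simp_all add: F_def)
        then show ?thesis by blast
      qed
      show "\<exists>t'\<in>F (Suc j). (t - {x}) \<union> {v, b (Suc j)} \<subseteq> t'" if S: "{w, b j} \<subseteq> t" and x: "x \<in> {w, b j}" for x
      proof -
        have facets: "{v, b j, b (Suc j)} \<in> F (Suc j)" "{v, w, b (Suc j)} \<in> F (Suc j)"
          by (auto simp: F_def)
        have "t = {v, w, b j} \<or> t = {w, b j, b (Suc j)}"
        proof -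
          consider "t \<in> R" | i where "j \<le> i" "i < r" "t = {w, b i, b (Suc i)}"
            | i where "i < j" "t = {v, b i, b (Suc i)}" | "t = {v, w, b 0}" | "t = {v, w, b j}"
            using t unfolding F_def by blast
          then show ?thesis
          proof cases
            case 1
            then show ?thesis using S Rw[of t j] j by auto
          next
            case (2 i)
            then show ?thesis using S mem[of i w j] mem[of i w "Suc j"] mem_v[of i] j by auto
          next
            case (3 i)
            then show ?thesis using S mem[of i v j] mem[of i v "Suc j"] mem_w[of i] j by auto
          next
            case 4
            then have False using S j wb[of 0] wb[of j] wb[of "Suc j"] beq[of j 0] beq[of "Suc j" 0] v by auto
            then show ?thesis ..
          qed simp
        qed
        then have "t - {x} \<union> {v, b (Suc j)} \<subseteq> {v, b j, b (Suc j)} \<or> t - {x} \<union> {v, b (Suc j)} \<subseteq> {v, w, b (Suc j)}"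
          using x by blast
        then show ?thesis using facets by blast
      qed
    qed
    show "bistellar_compatible {v, b (Suc j)} {w, b j} (F (Suc j)) (F j)"
    proof (rule bistellar_compatibleI)
      fix t assume t: "t \<in> F (Suc j)"
      show "finite t" using t R by (auto simp: F_def)
      show "\<not> {w, b j} \<subseteq> t" using t Rw[of t j] j v by (auto simp: F_def)
      show "\<exists>t'\<in>F j. t \<subseteq> t'" if n: "\<not> {v, b (Suc j)} \<subseteq> t"
      proof -
        have "t \<in> R \<or> (\<exists>i. Suc j \<le> i \<and> i < r \<and> t = {w, b i, b (Suc i)}) \<or>
           (\<exists>i. i < Suc j \<and> t = {v, b i, b (Suc i)}) \<or> t = {v, w, b 0}"
          using t n by (auto simp: F_def)
        moreover have "i \<noteq> j" if "t = {v, b i, b (Suc i)}" for i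
          using that n by auto
        ultimately consider "t \<in> R" | i where "Suc j \<le> i" "i < r" "t = {w, b i, b (Suc i)}"
          | i where "i < Suc j" "i \<noteq> j" "t = {v, b i, b (Suc i)}" | "t = {v, w, b 0}"
          by blast
        then have "t \<in> F j"
        proof cases
          case 2
          then have "j \<le> i" by simp
          then show ?thesis using 2 unfolding F_def by blast
        next
          case 3
          then have "i < j" by simp
          then show ?thesis using 3 unfolding F_def by blast
        qed (simp_all add: F_def)
        then show ?thesis by blast
      qed
      show "\<exists>t'\<in>F j. (t - {x}) \<union> {w, b j} \<subseteq> t'" if S: "{v, b (Suc j)} \<subseteq> t" and x: "x \<in> {v, b (Suc j)}" for x
      proof -
        have facets: "{w, b j, b (Suc j)} \<in> F j" "{v, w, b j} \<in> F j"
          using j by (auto simp: F_def)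
        have "t = {v, w, b (Suc j)} \<or> t = {v, b j, b (Suc j)}"
        proof -
          consider "t \<in> R" | i where "Suc j \<le> i" "i < r" "t = {w, b i, b (Suc i)}"
            | i where "i < Suc j" "t = {v, b i, b (Suc i)}" | "t = {v, w, b 0}" | "t = {v, w, b (Suc j)}"
            using t unfolding F_def by blast
          then show ?thesis
          proof cases
            case 1
            then show ?thesis using S R[of t] j by auto
          next
            case (2 i)
            then show ?thesis using S mem[of i w j] mem[of i w "Suc j"] mem_v[of i] j by auto
          next
            case (3 i)
            then show ?thesis using S mem[of i v j] mem[of i v "Suc j"] mem_w[of i] j by auto
          next
            case 4
            then have False using S j wb[of 0] wb[of j] wb[of "Suc j"] beq[of j 0] beq[of "Suc j" 0] v by auto
            then show ?thesis ..
          qed simp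
        qed
        then have "t - {x} \<union> {w, b j} \<subseteq> {w, b j, b (Suc j)} \<or> t - {x} \<union> {w, b j} \<subseteq> {v, w, b j}"
          using x by blast
        then show ?thesis using facets by blast
      qed
    qed
  qed auto
  \<comment> \<open>Stellar subdivision of the first triangle by \<open>v\<close>. Since
    \<open>r\<close> is at least 2, \<open>b 1\<close> is interior to the path, so no triangle of
    \<open>R\<close> contains \<open>{w, b 0, b 1}\<close>.\<close>
  have start: "geom_realization (faces (R \<union> {{w, b i, b (Suc i)} | i. i < r})) homeomorphic
      geom_realization (faces (F 1))"
  proof (rule homeomorphic_bistellar)
    let ?F = "R \<union> {{w, b i, b (Suc i)} | i. i < r}"
    have b01: "b 0 \<noteq> b 1" "v \<noteq> b 0" "v \<noteq> b 1" "w \<noteq> b 0" "w \<noteq> b 1"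
      using r beq[of 0 1] wb[of 0] wb[of 1] by auto
    show "{w, b 0, b 1} \<inter> {v} = {}" using r v by auto
    show "bistellar_compatible {w, b 0, b 1} {v} ?F (F 1)"
    proof (rule bistellar_compatibleI)
      fix t assume t: "t \<in> ?F"
      show "finite t" using t R by auto
      show "\<not> {v} \<subseteq> t" using t R mem_v by auto
      show "\<exists>t'\<in>F 1. t \<subseteq> t'" if n: "\<not> {w, b 0, b 1} \<subseteq> t"
      proof -
        have "t \<in> F 1"
        proof (cases "t \<in> R")
          case False
          then obtain i where i: "i < r" "t = {w, b i, b (Suc i)}" using t by auto
          then have "1 \<le> i" using n by (cases i) auto
          then show ?thesis using i unfolding F_def by blast
        qed (simp add: F_def)
        then show ?thesis by blast
      qed
      show "\<exists>t'\<in>F 1. (t - {x}) \<union> {v} \<subseteq> t'" if S: "{w, b 0, b 1} \<subseteq> t" and x: "x \<in> {w, b 0, b 1}" for x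
      proof -
        have facets: "{v, b 0, b 1} \<in> F 1" "{v, w, b 0} \<in> F 1" "{v, w, b 1} \<in> F 1"
          by (auto simp: F_def)
        have "t = {w, b 0, b 1}"
        proof (cases "t \<in> R")
          case True
          then show ?thesis using S Rw[of t 1] r by auto
        next
          case False
          then obtain i where i: "i < r" "t = {w, b i, b (Suc i)}" using t by auto
          then have "i = 0" using S mem[of i w 0] by auto
          then show ?thesis using i by simp
        qed
        then have "t - {x} \<union> {v} \<subseteq> {v, b 0, b 1} \<or> t - {x} \<union> {v} \<subseteq> {v, w, b 0} \<or> t - {x} \<union> {v} \<subseteq> {v, w, b 1}"
          using x by blast
        then show ?thesis using facets by blast
      qed
    qed
    show "bistellar_compatible {v} {w, b 0, b 1} (F 1) ?F"
    proof (rule bistellar_compatibleI)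
      fix t assume t: "t \<in> F 1"
      show "finite t" using t R by (auto simp: F_def)
      show "\<not> {w, b 0, b 1} \<subseteq> t"
      proof
        assume S: "{w, b 0, b 1} \<subseteq> t"
        then have "t \<notin> R" using Rw[of t 1] r by auto
        then consider i where "1 \<le> i" "i < r" "t = {w, b i, b (Suc i)}"
            | "t = {v, b 0, b 1}" | "t = {v, w, b 0}" | "t = {v, w, b 1}"
          using t unfolding F_def by auto
        then show False using S b01 v by cases (use mem[of _ w 0] S in auto)
      qed
      show "\<exists>t'\<in>?F. t \<subseteq> t'" if n: "\<not> {v} \<subseteq> t"
        using t n by (intro bexI[of _ t]) (auto simp: F_def)
      show "\<exists>t'\<in>?F. (t - {x}) \<union> {w, b 0, b 1} \<subseteq> t'" if S: "{v} \<subseteq> t" and x: "x \<in> {v}" for x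
      proof -
        have "t = {v, b 0, b 1} \<or> t = {v, w, b 0} \<or> t = {v, w, b 1}"
        proof -
          have "t \<notin> {{w, b i, b (Suc i)} | i. 1 \<le> i \<and> i < r}" using S mem_v by auto
          moreover have "t \<notin> R" using S R by auto
          ultimately show ?thesis using t by (auto simp: F_def)
        qed
        then show ?thesis
          using x r by (intro bexI[of _ "{w, b 0, b 1}"]) (auto intro!: exI[of _ 0])
      qed
    qed
  qed auto
  have "geom_realization (faces (F 1)) homeomorphic geom_realization (faces (F j))" if "1 \<le> j" "j \<le> r" for j
    using that
  proof (induction j rule: dec_induct)
    case base
    then show ?case by (simp add: homeomorphic_refl)
  next
    case (step i)
    then show ?case using step.IH flip[of i] homeomorphic_trans by auto
  qed
  then have "geom_realization (faces (F 1)) homeomorphic geom_realization (faces (F r))"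
    using r by auto
  moreover have "F r = R \<union> {{v, b i, b (Suc i)} | i. i < r} \<union> {{v, w, b 0}, {v, w, b r}}"
    by (auto simp: F_def)
  ultimately show ?thesis using start homeomorphic_trans by auto
qed

section \<open>Triangulated spheres\<close>

text \<open>Stereographic projection. The puncture \<open>q\<close> will always be a vertex outside
  the open set under study, so one global chart suffices; \<open>complex\<close> serves as the
  Euclidean plane.\<close>

lemma punctured_sphere_chart:
  fixes X :: "'a::topological_space set"
  assumes "X homeomorphic (sphere 0 1 :: (real ^ 3) set)" and "q \<in> X"
  obtains f g where "homeomorphism (X - {q}) (UNIV :: complex set) f g"
proof -
  obtain h k where hk: "homeomorphism X (sphere 0 1 :: (real ^ 3) set) h k"
    using assms(1) by (auto simp: homeomorphic_def)
  have hq: "h q \<in> sphere 0 1" using hk assms(2) by (auto simp: homeomorphism_def)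
  have img: "h ` (X - {q}) = sphere 0 1 - {h q}"
  proof -
    have "inj_on h X" using hk by (metis homeomorphism_def inj_on_inverseI)
    then have "h ` (X - {q}) = h ` X - h ` {q}"
      using assms(2) by (intro inj_on_image_set_diff) auto
    then show ?thesis using hk by (simp add: homeomorphism_def)
  qed
  have "homeomorphism (X - {q}) (sphere 0 1 - {h q}) h k"
    using homeomorphism_of_subsets[OF hk _ _ img] by auto
  then have 1: "(X - {q}) homeomorphic (sphere 0 1 - {h q})"
    by (auto simp: homeomorphic_def)
  define a :: "real ^ 3" where "a = axis 1 1"
  have a0: "a \<noteq> 0" by (simp add: a_def)
  have 2: "(sphere 0 1 - {h q}) homeomorphic {x. a \<bullet> x = 0}"
    by (rule homeomorphic_punctured_sphere_hyperplane) (use hq a0 in auto)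
  have 3: "{x. a \<bullet> x = 0} homeomorphic (UNIV :: complex set)"
    using a0 by (intro homeomorphic_subspaces) (auto simp: subspace_hyperplane dim_hyperplane)
  show ?thesis
    using that homeomorphic_trans[OF homeomorphic_trans[OF 1 2] 3] by (auto simp: homeomorphic_def)
qed

text \<open>Otherwise the preimage of \<open>B\<close> would be \<open>{0}\<close>, which is clopen
  in the connected half-open interval. It is applied to segments, to find points close to the start
  but different from it.\<close>

lemma path_leaves_start:
  fixes p :: "real \<Rightarrow> 'b::topological_space"
  assumes "continuous_on {0..<1} p" "open B" "p 0 \<in> B"
  obtains s where "0 < s" "s < 1" "p s \<in> B"
proof (rule ccontr)
  assume "\<not> thesis"
  then have eq: "{0..<1} \<inter> p -` B = {0}"
  proof (intro set_eqI iffI)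
    fix s assume s: "s \<in> {0..<1} \<inter> p -` B"
    show "s \<in> {0}"
    proof (rule ccontr)
      assume "s \<notin> {0}"
      then have "thesis" using s that[of s] by simp
      with \<open>\<not> thesis\<close> show False ..
    qed
  qed (use assms(3) in auto)
  have "openin (top_of_set {0..<1}) {0::real}"
    using continuous_openin_preimage_gen[OF assms(1,2)] eq by simp
  moreover have "closedin (top_of_set {0..<1}) {0::real}"
    by (simp add: closed_subset)
  moreover have "connected {0..<1::real}" by simp
  ultimately have "{0} = {0..<1::real}"
    using connected_clopen by blast
  moreover have "(1/2::real) \<in> {0..<1}" by simp
  ultimately show False by (metis divide_eq_0_iff singletonD zero_neq_numeral zero_neq_one)
qed

definition blend :: "('a \<Rightarrow> real) \<Rightarrow> ('a \<Rightarrow> real) \<Rightarrow> real \<Rightarrow> 'a \<Rightarrow> real" where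
  "blend f g s = (\<lambda>v. (1 - s) * f v + s * g v)"

lemma continuous_on_blend: "continuous_on A (blend f g)"
  unfolding blend_def by (intro continuous_on_coordinatewise_then_product continuous_intros)

lemma blend_in_realization:
  assumes "t \<in> F" "\<And>t. t \<in> F \<Longrightarrow> finite t"
    and "\<And>v. 0 \<le> f v" "\<And>v. 0 \<le> g v" "\<And>v. v \<notin> t \<Longrightarrow> f v = 0" "\<And>v. v \<notin> t \<Longrightarrow> g v = 0"
    and "sum f t = 1" "sum g t = 1" and "0 \<le> s" "s \<le> 1"
  shows "blend f g s \<in> geom_realization (faces F)"
proof -
  have "sum (blend f g s) t = (1 - s) * sum f t + s * sum g t"
    by (simp add: blend_def sum.distrib sum_distrib_left)
  then have "sum (blend f g s) t = 1" using assms by simp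
  moreover have "0 \<le> blend f g s v" for v using assms by (simp add: blend_def)
  moreover have "blend f g s v = 0" if "v \<notin> t" for v using assms that by (simp add: blend_def)
  ultimately show ?thesis
    using assms(1,2) by (subst geom_realization_faces) auto
qed

abbreviation (input) is_triangulated_sphere :: "'a set set \<Rightarrow> bool" where
  "is_triangulated_sphere F \<equiv> geom_realization (faces F) homeomorphic (sphere 0 1 :: (real ^ 3) set)"

abbreviation (input) vertex_point :: "'a \<Rightarrow> 'a \<Rightarrow> real" where
  "vertex_point x \<equiv> (\<lambda>v. if v = x then 1 else 0)"

lemma vertex_point_in_realization:
  assumes "t \<in> F" "x \<in> t" "\<And>t. t \<in> F \<Longrightarrow> finite t"
  shows "vertex_point x \<in> geom_realization (faces F)"
  using assms by (subst geom_realization_faces) (auto intro!: bexI[of _ t])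

lemma card_3_Ex:
  assumes "card t = 3" "x \<in> t" "y \<in> t" "x \<noteq> y"
  obtains z where "t = {x, y, z}" "z \<noteq> x" "z \<noteq> y"
proof -
  have fin: "finite t" using assms by (auto intro: card_ge_0_finite)
  have "card (t - {x, y}) = 1" using assms fin by (simp add: card_Diff_subset)
  then obtain z where z: "t - {x, y} = {z}" by (auto simp: card_1_singleton_iff)
  then have "t = {x, y, z}" "z \<noteq> x" "z \<noteq> y" using assms by auto
  then show ?thesis by (rule that)
qed

lemma card_3_distinct: "card {x, y, z} = 3 \<Longrightarrow> x \<noteq> y \<and> x \<noteq> z \<and> y \<noteq> z"
  by (auto simp: card_insert_if split: if_splits)

text \<open>If \<open>{x, y, z}\<close> were the only triangle on the edge, the open star of the
  edge would be a half disc with the edge on its boundary. Mapped into the plane, it would be open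
  by invariance of domain and yet lie in a closed half-plane through the image of the
  midpoint.\<close>

lemma triangulated_sphere_edge_in_second_triangle:
  fixes F :: "'a set set"
  assumes sph: "is_triangulated_sphere F" and F3: "\<And>t. t \<in> F \<Longrightarrow> card t = 3"
    and xyz: "{x, y, z} \<in> F"
  shows "\<exists>u. u \<noteq> z \<and> {x, y, u} \<in> F"
proof (rule ccontr)
  assume "\<not> ?thesis"
  then have only: "u = z" if "{x, y, u} \<in> F" for u using that by auto
  define X where "X = geom_realization (faces F)"
  have fin: "\<And>t. t \<in> F \<Longrightarrow> finite t" using F3 by (metis card.infinite zero_neq_numeral)
  have dist: "x \<noteq> y" "x \<noteq> z" "y \<noteq> z" using card_3_distinct[OF F3[OF xyz]] by auto
  define q where "q = vertex_point x"
  have q: "q \<in> X" unfolding q_def X_def by (rule vertex_point_in_realization[OF xyz]) (use fin in auto)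
  obtain f g where fg: "homeomorphism (X - {q}) (UNIV :: complex set) f g"
    using punctured_sphere_chart sph q unfolding X_def by blast
  \<comment> \<open>The open star of the edge; the condition at \<open>y\<close> also keeps it away
    from the puncture at \<open>x\<close>.\<close>
  define U where "U = {p \<in> X - {q}. 0 < p x \<and> 0 < p y}"
  have opU: "openin (top_of_set (X - {q})) U"
  proof -
    have "open {p :: 'a \<Rightarrow> real. 0 < p x \<and> 0 < p y}"
      by (intro open_Collect_conj open_Collect_less continuous_on_const continuous_on_coordinate)
    moreover have "U = (X - {q}) \<inter> {p. 0 < p x \<and> 0 < p y}" by (auto simp: U_def)
    ultimately show ?thesis by (auto simp: openin_open)
  qed
  have opfU: "open (f ` U)"
    using homeomorphism_imp_open_map[OF fg opU] by simp
  have U: "(\<forall>v. v \<notin> {x, y, z} \<longrightarrow> p v = 0) \<and> p x + p y + p z = 1 \<and> 0 \<le> p z" if p: "p \<in> U" for p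
  proof -
    obtain t where t: "t \<in> F" "\<And>v. v \<notin> t \<Longrightarrow> p v = 0" "sum p t = 1"
      using p fin by (auto simp: U_def X_def geom_realization_faces)
    have "x \<in> t" "y \<in> t" using p t(2)[of x] t(2)[of y] by (auto simp: U_def)
    then obtain u where "t = {x, y, u}"
      using card_3_Ex[OF F3[OF t(1)] _ _ dist(1)] by metis
    then have "t = {x, y, z}" using only t(1) by auto
    moreover have "0 \<le> p z" using p fin by (auto simp: U_def X_def geom_realization_faces)
    ultimately show ?thesis using t dist by auto
  qed
  \<comment> \<open>Planar coordinates of the triangle: together with the sum being 1 they determine
    all three weights, and the real part is nonnegative on \<open>U\<close>.\<close>
  define c where "c p = Complex (p z) (p x - p y)" for p :: "'a \<Rightarrow> real"
  have contc: "continuous_on A c" for A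
    unfolding c_def Complex_eq
    by (intro continuous_intros continuous_on_coordinate)
  have injc: "inj_on c U"
  proof (rule inj_onI)
    fix p p' assume pp: "p \<in> U" "p' \<in> U" "c p = c p'"
    have e: "p z = p' z" "p x - p y = p' x - p' y" using pp(3) by (auto simp: c_def)
    show "p = p'"
    proof
      fix v
      have "p x = p' x" "p y = p' y" using U[OF pp(1)] U[OF pp(2)] e by linarith+
      then show "p v = p' v"
        using U[OF pp(1)] U[OF pp(2)] e by (cases "v \<in> {x, y, z}") auto
    qed
  qed
  have gf: "g (f p) = p" if "p \<in> U" for p
    using fg that by (auto simp: U_def homeomorphism_def)
  have gfU: "g ` (f ` U) = U" using gf by (force simp: image_iff)
  have "open ((c \<circ> g) ` (f ` U))"
  proof (rule invariance_of_domain)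
    have "continuous_on (f ` U) g"
      using fg by (auto simp: homeomorphism_def intro: continuous_on_subset)
    then show "continuous_on (f ` U) (c \<circ> g)" by (intro continuous_on_compose contc)
    have "inj_on g (f ` U)" using gf by (auto intro: inj_onI)
    then show "inj_on (c \<circ> g) (f ` U)" using injc gfU by (intro comp_inj_on) auto
  qed (rule opfU)
  then have opc: "open (c ` U)" by (simp only: image_comp[symmetric] gfU)
  define mid where "mid = (\<lambda>v. if v = x \<or> v = y then 1/2 else 0 :: real)"
  have "mid \<in> X" unfolding X_def using xyz fin dist
    by (subst geom_realization_faces) (auto simp: mid_def intro!: bexI[of _ "{x, y, z}"])
  moreover have "mid \<noteq> q" using dist unfolding mid_def q_def by (auto simp: fun_eq_iff intro!: exI[of _ x])
  ultimately have "mid \<in> U" by (auto simp: U_def mid_def)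
  then have "c mid \<in> c ` U" by simp
  moreover have "c mid = 0" using dist by (auto simp: c_def mid_def complex_eq_iff)
  ultimately obtain e where e: "e > 0" "ball 0 e \<subseteq> c ` U"
    using opc by (metis open_contains_ball)
  have "Complex (- e / 2) 0 \<in> ball 0 e" using e(1) by (simp add: cmod_def)
  then obtain p where "p \<in> U" "Complex (- e / 2) 0 = c p" using e(2) by blast
  then show False using U[of p] e(1) by (auto simp: c_def)
qed

text \<open>Two triangles on the edge already form an embedded disc around its midpoint, which is
  open by invariance of domain. The segment from the midpoint into the third triangle would have to
  begin inside this disc, although its points have positive weight at \<open>z3\<close>.\<close>

lemma triangulated_sphere_edge_not_in_three_triangles:
  fixes F :: "'a set set"
  assumes sph: "is_triangulated_sphere F" and F3: "\<And>t. t \<in> F \<Longrightarrow> card t = 3"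
    and tri: "{x, y, z1} \<in> F" "{x, y, z2} \<in> F" "{x, y, z3} \<in> F"
    and neq: "z1 \<noteq> z2" "z1 \<noteq> z3" "z2 \<noteq> z3"
  shows False
proof -
  define X where "X = geom_realization (faces F)"
  have fin: "\<And>t. t \<in> F \<Longrightarrow> finite t" using F3 by (metis card.infinite zero_neq_numeral)
  have dist: "x \<noteq> y" "x \<noteq> z1" "y \<noteq> z1" "x \<noteq> z2" "y \<noteq> z2" "x \<noteq> z3" "y \<noteq> z3"
    using card_3_distinct[OF F3[OF tri(1)]] card_3_distinct[OF F3[OF tri(2)]]
      card_3_distinct[OF F3[OF tri(3)]] by auto
  define q where "q = vertex_point x"
  have q: "q \<in> X" unfolding q_def X_def by (rule vertex_point_in_realization[OF tri(1)]) (use fin in auto)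
  obtain f g where fg: "homeomorphism (X - {q}) (UNIV :: complex set) f g"
    using punctured_sphere_chart sph q unfolding X_def by blast
  define D where "D = {c. \<bar>Re c\<bar> + \<bar>Im c\<bar> < 1}"
  have opD: "open D" unfolding D_def
    by (intro open_Collect_less continuous_intros)
  \<comment> \<open>The disc obtained by gluing two triangles along the edge: the real part gives
    the weight of \<open>z1\<close> or, if negative, of \<open>z2\<close>; the remaining weight is
    shared by \<open>x\<close> and \<open>y\<close> with difference \<open>Im c\<close>. The weight
    of \<open>y\<close> stays positive on \<open>D\<close>, so the puncture is avoided.\<close>
  define e where "e c = (\<lambda>v. if v = x then (1 - \<bar>Re c\<bar> + Im c) / 2 else if v = y then (1 - \<bar>Re c\<bar> - Im c) / 2
      else if v = z1 then max (Re c) 0 else if v = z2 then max (- Re c) 0 else 0)" for c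
  have eX: "e c \<in> X - {q}" if c: "c \<in> D" for c
  proof -
    have pos: "0 \<le> e c v" for v using c by (auto simp: e_def D_def)
    have "\<exists>t\<in>F. (\<forall>v. v \<notin> t \<longrightarrow> e c v = 0) \<and> sum (e c) t = 1"
    proof (cases "Re c \<ge> 0")
      case True
      then show ?thesis using dist neq tri by (intro bexI[of _ "{x, y, z1}"]) (auto simp: e_def field_simps)
    next
      case False
      then show ?thesis using dist neq tri by (intro bexI[of _ "{x, y, z2}"]) (auto simp: e_def field_simps)
    qed
    then have "e c \<in> X" using pos fin by (simp add: X_def geom_realization_faces)
    moreover have "e c y > 0" using c dist by (auto simp: e_def D_def)
    then have "e c \<noteq> q" using dist by (auto simp: q_def)
    ultimately show ?thesis by simp
  qed
  have conte: "continuous_on A e" for A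
  proof (rule continuous_on_coordinatewise_then_product)
    fix v
    show "continuous_on A (\<lambda>c. e c v)"
      unfolding e_def by (cases "v = x"; cases "v = y"; cases "v = z1"; cases "v = z2")
        (auto intro!: continuous_intros)
  qed
  have inje: "inj_on e D"
  proof (rule inj_onI)
    fix c c' assume "e c = e c'"
    then have 1: "e c v = e c' v" for v by simp
    from 1[of z1] 1[of z2] have "Re c = Re c'" using dist neq by (auto simp: e_def max_def split: if_splits)
    moreover from this 1[of x] have "Im c = Im c'" by (simp add: e_def)
    ultimately show "c = c'" by (simp add: complex_eq_iff)
  qed
  define B where "B = (f \<circ> e) ` D"
  have opB: "open B"
    unfolding B_def
  proof (rule invariance_of_domain)
    have "continuous_on (e ` D) f"
      using fg eX by (auto simp: homeomorphism_def intro: continuous_on_subset)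
    then show "continuous_on D (f \<circ> e)" by (intro continuous_on_compose conte)
    have "inj_on f (X - {q})" using fg by (metis homeomorphism_def inj_on_inverseI)
    then have "inj_on f (e ` D)" using eX by (auto intro: inj_on_subset)
    then show "inj_on (f \<circ> e) D" using inje by (intro comp_inj_on) auto
  qed (rule opD)
  define mid where "mid = (\<lambda>v. if v = x \<or> v = y then 1/2 else 0 :: real)"
  have mid: "mid = e 0" using dist by (auto simp: mid_def e_def fun_eq_iff)
  define p where "p = blend mid (vertex_point z3)"
  have pX: "p s \<in> X - {q}" if "s \<in> {0..<1}" for s
  proof -
    have "p s \<in> X" unfolding p_def X_def
      by (rule blend_in_realization[OF tri(3)]) (use fin that dist in \<open>auto simp: mid_def\<close>)
    moreover have "p s y > 0" using that dist by (auto simp: p_def blend_def mid_def)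
    then have "p s \<noteq> q" using dist by (auto simp: q_def)
    ultimately show ?thesis by simp
  qed
  have "continuous_on {0..<1} (f \<circ> p)"
  proof (rule continuous_on_compose)
    show "continuous_on {0..<1} p" unfolding p_def by (rule continuous_on_blend)
    show "continuous_on (p ` {0..<1}) f"
      using homeomorphism_cont1[OF fg] by (rule continuous_on_subset) (use pX in blast)
  qed
  moreover have "(f \<circ> p) 0 \<in> B"
  proof -
    have "p 0 = e 0" by (simp add: p_def blend_def mid[symmetric])
    moreover have "0 \<in> D" by (simp add: D_def)
    ultimately show ?thesis by (auto simp: B_def)
  qed
  ultimately obtain s where s: "0 < s" "s < 1" "(f \<circ> p) s \<in> B"
    using path_leaves_start[OF _ opB] by blast
  then obtain c where c: "c \<in> D" "f (p s) = f (e c)" by (auto simp: B_def)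
  have "p s = e c"
    using fg pX[of s] eX[OF c(1)] c(2) s by (metis atLeastLessThan_iff homeomorphism_def less_eq_real_def)
  then have "p s z3 = e c z3" by simp
  then show False using s dist neq by (auto simp: p_def e_def blend_def mid_def)
qed

lemma triangulated_sphere_edge_degree:
  fixes F :: "'a set set"
  assumes sph: "is_triangulated_sphere F" and F3: "\<And>t. t \<in> F \<Longrightarrow> card t = 3"
    and tri: "{x, y, z} \<in> F"
  obtains z' where "z' \<noteq> z" "\<And>u. {x, y, u} \<in> F \<longleftrightarrow> u = z \<or> u = z'"
proof -
  obtain z' where z': "z' \<noteq> z" "{x, y, z'} \<in> F"
    using triangulated_sphere_edge_in_second_triangle[OF sph F3 tri] by auto
  then show ?thesis
    using triangulated_sphere_edge_not_in_three_triangles[OF sph F3 tri z'(2)] tri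
    by (intro that[of z']) blast+
qed

text \<open>A small punctured disc around the point \<open>w\<close> of the surface is connected.
  Every point of it has positive weight at a neighbour of \<open>w\<close>; if \<open>P\<close> is
  closed under adjacency in the link, being weighted inside \<open>P\<close> or outside
  \<open>P\<close> separates the disc into two open sets, and segments from \<open>w\<close> towards
  \<open>a\<close> and \<open>y\<close> meet both.\<close>

lemma triangulated_sphere_link_connected:
  fixes F :: "'a set set"
  assumes sph: "is_triangulated_sphere F" and F3: "\<And>t. t \<in> F \<Longrightarrow> card t = 3"
    and closed: "\<And>y z. {w, y, z} \<in> F \<Longrightarrow> y \<in> P \<Longrightarrow> z \<in> P"
    and start: "{w, a, a'} \<in> F" "a \<in> P" and tri: "{w, y, z} \<in> F"
  shows "y \<in> P"
proof (rule ccontr)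
  assume yP: "y \<notin> P"
  define X where "X = geom_realization (faces F)"
  have fin: "\<And>t. t \<in> F \<Longrightarrow> finite t" using F3 by (metis card.infinite zero_neq_numeral)
  have dist: "w \<noteq> a" "w \<noteq> y" "a \<noteq> y" using card_3_distinct[OF F3[OF start(1)]] card_3_distinct[OF F3[OF tri]] start(2) yP by auto
  \<comment> \<open>Any vertex other than \<open>w\<close> serves as the puncture: points with
    positive weight at \<open>w\<close> differ from it.\<close>
  define q where "q = vertex_point a"
  have q: "q \<in> X" unfolding q_def X_def by (rule vertex_point_in_realization[OF start(1)]) (use fin in auto)
  obtain f g where fg: "homeomorphism (X - {q}) (UNIV :: complex set) f g"
    using punctured_sphere_chart sph q unfolding X_def by blast
  have gf: "\<And>p. p \<in> X - {q} \<Longrightarrow> g (f p) = p" and fgc: "\<And>c. f (g c) = c"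
    and gX: "\<And>c. g c \<in> X - {q}" and contf: "continuous_on (X - {q}) f" and contg: "\<And>A. continuous_on A g"
    using fg by (auto simp: homeomorphism_def intro: continuous_on_subset)
  define W where "W = {p \<in> X - {q}. 0 < p w}"
  have opO: "openin (top_of_set (X - {q})) W"
  proof -
    have "open {p :: 'a \<Rightarrow> real. 0 < p w}"
      by (intro open_Collect_less continuous_on_const continuous_on_coordinate)
    moreover have "W = (X - {q}) \<inter> {p. 0 < p w}" by (auto simp: W_def)
    ultimately show ?thesis by (auto simp: openin_open)
  qed
  have opfO: "open (f ` W)"
    using homeomorphism_imp_open_map[OF fg opO] by simp
  define d where "d = vertex_point w"
  have "d \<in> X" unfolding d_def X_def by (rule vertex_point_in_realization[OF tri]) (use fin in auto)
  moreover have "d \<noteq> q" using dist by (auto simp: d_def q_def fun_eq_iff)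
  ultimately have d: "d \<in> X - {q}" "d \<in> W" by (auto simp: W_def d_def)
  then obtain e where e: "e > 0" "ball (f d) e \<subseteq> f ` W"
    using opfO by (meson imageI open_contains_ball)
  define C where "C = ball (f d) e - {f d}"
  have connC: "connected (g ` C)"
    unfolding C_def by (intro connected_continuous_image contg connected_punctured_ball) simp
  have CO: "p \<in> W" "p \<noteq> d" if pC: "p \<in> g ` C" for p
  proof -
    obtain c where c: "c \<in> C" "p = g c" using pC by auto
    then obtain p' where "p' \<in> W" "c = f p'" using e(2) by (auto simp: C_def)
    then show "p \<in> W" using c gf by (auto simp: W_def)
    show "p \<noteq> d" using c fgc by (auto simp: C_def)
  qed
  \<comment> \<open>The weight at \<open>w\<close> itself is disregarded, because it is positive on
    both sides.\<close>
  define U where "U A = (\<Union>v\<in>A - {w}. {p :: 'a \<Rightarrow> real. 0 < p v})" for A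
  have opU: "open (U A)" for A
    unfolding U_def by (intro open_UN ballI open_Collect_less continuous_on_const continuous_on_coordinate)
  have Odesc: "\<exists>u u'. {w, u, u'} \<in> F \<and> (\<forall>v. v \<notin> {w, u, u'} \<longrightarrow> p v = 0) \<and> (0 < p u \<or> 0 < p u')
      \<and> u \<noteq> w \<and> u' \<noteq> w"
    if p: "p \<in> W" "p \<noteq> d" for p
  proof -
    obtain t where t: "t \<in> F" "\<And>v. v \<notin> t \<Longrightarrow> p v = 0" "sum p t = 1"
      using p fin by (auto simp: W_def X_def geom_realization_faces)
    have p0: "0 \<le> p v" for v using p fin by (auto simp: W_def X_def geom_realization_faces)
    have wt: "w \<in> t" using p t(2)[of w] by (auto simp: W_def)
    obtain u where u: "u \<in> t" "u \<noteq> w"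
    proof (rule ccontr)
      assume "\<not> thesis"
      then have "t \<subseteq> {w}" using that by auto
      then have "card t \<le> 1" using card_mono[of "{w}" t] by simp
      then show False using F3[OF t(1)] by simp
    qed
    obtain u' where u': "t = {w, u, u'}" "u' \<noteq> w" "u' \<noteq> u"
      using card_3_Ex[OF F3[OF t(1)] wt u(1)] u(2) by metis
    have "0 < p u \<or> 0 < p u'"
    proof (rule ccontr)
      assume "\<not> ?thesis"
      then have 0: "p u = 0" "p u' = 0" using p0[of u] p0[of u'] by linarith+
      then have "p w = 1" using t(3) u' u by auto
      then have "p = d" using 0 t(2) u' by (auto simp: d_def fun_eq_iff)
      then show False using p by simp
    qed
    then show ?thesis using t u' u by auto
  qed
  have closed': "u \<in> P \<longleftrightarrow> u' \<in> P" if "{w, u, u'} \<in> F" for u u'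
    using closed[of u u'] closed[of u' u] that by (auto simp: insert_commute)
  have cover: "g ` C \<subseteq> U P \<union> U (- P)"
  proof
    fix p assume "p \<in> g ` C"
    then obtain u u' where "0 < p u \<or> 0 < p u'" "u \<noteq> w" "u' \<noteq> w"
      using Odesc CO by metis
    then obtain x where "0 < p x" "x \<noteq> w" by blast
    then show "p \<in> U P \<union> U (- P)" by (cases "x \<in> P") (auto simp: U_def)
  qed
  have disj: "U P \<inter> U (- P) \<inter> g ` C = {}"
  proof (rule ccontr)
    assume "\<not> ?thesis"
    then obtain p where p: "p \<in> U P" "p \<in> U (- P)" "p \<in> g ` C" by auto
    obtain u u' where uu: "{w, u, u'} \<in> F" "\<And>v. v \<notin> {w, u, u'} \<Longrightarrow> p v = 0"
      using Odesc[OF CO[OF p(3)]] by blast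
    obtain v v' where v: "v \<in> P" "v \<noteq> w" "0 < p v" "v' \<notin> P" "v' \<noteq> w" "0 < p v'"
      using p by (auto simp: U_def)
    then have "v \<in> {u, u'}" "v' \<in> {u, u'}" using uu(2)[of v] uu(2)[of v'] by auto
    then show False using closed'[OF uu(1)] v by auto
  qed
  have meets: "U A \<inter> g ` C \<noteq> {}" if b: "{w, b, b'} \<in> F" "b \<in> A" for b b' A
  proof -
    have bw: "w \<noteq> b" using card_3_distinct[OF F3[OF b(1)]] by simp
    define p where "p = blend d (vertex_point b)"
    have pX: "p s \<in> X - {q}" if "s \<in> {0..<1}" for s
    proof -
      have "p s \<in> X" unfolding p_def X_def d_def
        by (rule blend_in_realization[OF b(1)]) (use fin[OF b(1)] fin that bw in auto)
      moreover have "p s w > 0" using that bw by (auto simp: p_def blend_def d_def)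
      then have "p s \<noteq> q" using dist by (auto simp: q_def)
      ultimately show ?thesis by simp
    qed
    have "continuous_on {0..<1} (f \<circ> p)"
    proof (rule continuous_on_compose)
      show "continuous_on {0..<1} p" unfolding p_def by (rule continuous_on_blend)
      show "continuous_on (p ` {0..<1}) f"
        using contf by (rule continuous_on_subset) (use pX in blast)
    qed
    moreover have p0: "p 0 = d" by (simp add: p_def blend_def)
    then have "(f \<circ> p) 0 \<in> ball (f d) e" using e(1) by simp
    ultimately obtain s where s: "0 < s" "s < 1" "(f \<circ> p) s \<in> ball (f d) e"
      using path_leaves_start[OF _ open_ball] by blast
    have ps: "p s b = s" using bw by (simp add: p_def blend_def d_def)
    have psX: "p s \<in> X - {q}" using pX s by simp
    have "d b = 0" using bw by (simp add: d_def)
    then have "p s \<noteq> d" using ps s(1) by auto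
    then have "f (p s) \<noteq> f d" using gf[OF psX] gf[OF d(1)] by metis
    then have "f (p s) \<in> C" using s by (simp add: C_def)
    then have "p s \<in> g ` C" using gf[OF psX] by (metis imageI)
    moreover have "p s \<in> U A" using ps s(1) b(2) bw by (auto simp: U_def intro!: bexI[of _ b])
    ultimately show ?thesis by blast
  qed
  show False
    using connectedD[OF connC opU opU disj cover] meets[OF start] meets[OF tri, of "- P"] yP by auto
qed

section \<open>Vertex links of cyclic complexes\<close>

text \<open>The tetrahedra of \<open>(a : b : c : e)\<close> containing a vertex \<open>v\<close> consist of \<open>v\<close> and of \<open>v + z\<close> for \<open>z\<close> in one
  of these triangles.\<close>

definition quad :: "int \<Rightarrow> int \<Rightarrow> int \<Rightarrow> int set set" where
  "quad a b c = {{a, a + b, a + b + c}, {- a, b, b + c}, {- a - b, - b, c}, {- a - b - c, - b - c, - c}}"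

definition residue :: "nat \<Rightarrow> nat \<Rightarrow> int \<Rightarrow> nat" where
  "residue N v z = nat ((int v + z) mod int N)"

lemma residue_eq_iff:
  assumes "N > 0"
  shows "residue N v z = residue N v' z' \<longleftrightarrow> (int v + z) mod int N = (int v' + z') mod int N"
  using assms by (auto simp: residue_def nat_eq_iff)

lemma residue_0: "v < N \<Longrightarrow> residue N v 0 = v"
  by (simp add: residue_def)

lemma residue_less: "N > 0 \<Longrightarrow> residue N v z < N"
  by (simp add: residue_def nat_less_iff)

lemma residue_shift: "residue N v (z + int N) = residue N v z"
  by (simp add: residue_def add.assoc[symmetric])

lemma diff_cycle_4:
  "diff_cycle [a, b, c, e] =
    {residue (a + b + c + e) x ` {0, int a, int a + int b, int a + int b + int c} | x. x < a + b + c + e}"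
proof -
  have "{(x + sum_list (take i [a, b, c, e])) mod sum_list [a, b, c, e] | i. i < length [a, b, c, e]} =
     residue (a + b + c + e) x ` {0, int a, int a + int b, int a + int b + int c}" for x
  proof -
    have "{i. i < length [a, b, c, e]} = {0, 1, 2, 3}" by auto
    then have "{(x + sum_list (take i [a, b, c, e])) mod sum_list [a, b, c, e] | i. i < length [a, b, c, e]} =
       (\<lambda>i. (x + sum_list (take i [a, b, c, e])) mod sum_list [a, b, c, e]) ` {0, 1, 2, 3}"
      by blast
    then show ?thesis
      by (simp add: residue_def nat_mod_distrib nat_add_distrib add.assoc numeral_2_eq_2 numeral_3_eq_3
           flip: of_nat_add of_nat_mod)
  qed
  note eq = this
  have sum: "sum_list [a, b, c, e] = a + b + c + e" by simp
  show ?thesis unfolding diff_cycle_def eq unfolding sum ..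
qed

text \<open>With \<open>P\<close> the set of partial sums, the translate of \<open>P\<close> by
  \<open>x\<close> contains \<open>v\<close> exactly when \<open>x = v - p\<close> modulo
  \<open>N\<close> for some \<open>p\<close> in \<open>P\<close>. The offsets from \<open>v\<close>
  then form \<open>P - p\<close>, one set for each of the four choices of \<open>p\<close>.\<close>

lemma diff_cycle_star:
  assumes N: "N = a + b + c + e" and v: "v < N"
  shows "{t \<in> diff_cycle [a, b, c, e]. v \<in> t} = (\<lambda>t. residue N v ` insert 0 t) ` quad (int a) (int b) (int c)"
proof -
  define P where "P = {0, int a, int a + int b, int a + int b + int c}"
  have N0: "N > 0" using v by simp
  have "{t \<in> diff_cycle [a, b, c, e]. v \<in> t} = (\<lambda>p. residue N v ` (\<lambda>z. z - p) ` P) ` P"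
  proof (intro equalityI subsetI)
    fix t assume "t \<in> {t \<in> diff_cycle [a, b, c, e]. v \<in> t}"
    then obtain x p where x: "t = residue N x ` P" "p \<in> P" "v = residue N x p"
      unfolding diff_cycle_4 N[symmetric] P_def[symmetric] by auto
    have "residue N v (z - p) = residue N x z" for z
    proof -
      have "int v = (int x + p) mod int N" using x(3) N0 by (simp add: residue_def)
      then have "(int v + (z - p)) mod int N = (int x + p + (z - p)) mod int N"
        by (simp only: mod_add_left_eq)
      then show ?thesis using N0 by (simp add: residue_eq_iff)
    qed
    then have "t = residue N v ` (\<lambda>z. z - p) ` P" by (simp add: x(1) image_image)
    then show "t \<in> (\<lambda>p. residue N v ` (\<lambda>z. z - p) ` P) ` P" using x(2) by blast
  next
    fix t assume "t \<in> (\<lambda>p. residue N v ` (\<lambda>z. z - p) ` P) ` P"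
    then obtain p where p: "p \<in> P" "t = residue N v ` (\<lambda>z. z - p) ` P" by auto
    define x where "x = residue N v (- p)"
    have "residue N v (z - p) = residue N x z" for z
    proof -
      have "int x = (int v - p) mod int N" using N0 by (simp add: residue_def x_def)
      then have "(int x + z) mod int N = (int v - p + z) mod int N"
        by (simp only: mod_add_left_eq)
      then show ?thesis using N0 by (simp add: residue_eq_iff algebra_simps)
    qed
    then have eq: "t = residue N x ` P" by (simp add: p(2) image_image)
    have "v = residue N v (p - p)" using v by (simp add: residue_0)
    then have "v \<in> t" using p by blast
    moreover have "x < N" unfolding x_def by (rule residue_less[OF N0])
    ultimately show "t \<in> {t \<in> diff_cycle [a, b, c, e]. v \<in> t}"
      using eq unfolding diff_cycle_4 N[symmetric] P_def[symmetric] by auto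
  qed
  also have "\<dots> = (\<lambda>t. residue N v ` t) ` ((\<lambda>p. (\<lambda>z. z - p) ` P) ` P)"
    by (simp only: image_image)
  also have "(\<lambda>p. (\<lambda>z. z - p) ` P) ` P = insert 0 ` quad (int a) (int b) (int c)"
    by (simp add: P_def quad_def insert_commute algebra_simps)
  finally show ?thesis by (simp only: image_image)
qed

locale cyclic_family =
  fixes n m h :: nat and d :: "nat \<Rightarrow> nat \<Rightarrow> nat"
  assumes n: "n = 2 * h" and h2: "h \<ge> 2"
    and dpos: "\<And>i j. i \<in> {1..m} \<Longrightarrow> j \<le> 3 \<Longrightarrow> 0 < d i j"
    and dsum: "\<And>i. i \<in> {1..m} \<Longrightarrow> d i 0 + d i 1 + d i 2 + d i 3 = n"
begin

definition old_triangles :: "int set set" where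
  "old_triangles = (\<Union>i\<in>{1..m}. quad (int (d i 0)) (int (d i 1)) (int (d i 2)))"

text \<open>The cycles \<open>(1 : l - 1 : 1 : n + k - l - 1)\<close> occur only for \<open>l \<le> (n + k)/2\<close>, with two triangles of
  each in negative position; modulo \<open>n + k\<close> these are the triangles below for \<open>j = n + k - l\<close>.\<close>

definition fan_triangles :: "nat \<Rightarrow> int set set" where
  "fan_triangles k = (\<Union>j\<in>{int h..int h + int k}. {{1, j, j + 1}, {- 1, j - 1, j}})"

definition tetrahedra :: "nat \<Rightarrow> nat set set" where
  "tetrahedra k = \<Union>(diff_cycle ` (ext_cycle d k ` {1..m} \<union>
       {[1, l - 1, 1, n + k - l - 1] | l. n div 2 \<le> l \<and> l \<le> (n + k) div 2}))"

lemma ext_cplx_eq: "ext_cplx n m d k = faces (tetrahedra k)"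
  by (simp add: ext_cplx_def tetrahedra_def diff_cplx_eq_faces)

text \<open>Rotation by two entries exchanges \<open>l\<close> with \<open>n + k - l\<close>. Thus
  one cycle accounts for the triangles of both indices, and as \<open>l\<close> runs from
  \<open>h\<close> to half of \<open>n + k\<close>, the pairs exhaust the whole range from
  \<open>h\<close> to \<open>h + k\<close>.\<close>

lemma fan_star:
  assumes v: "v < n + k"
  shows "(\<Union>l\<in>{h..(n + k) div 2}. (\<lambda>t. residue (n + k) v ` insert 0 t) ` quad 1 (int (l - 1)) 1) =
     (\<lambda>t. residue (n + k) v ` insert 0 t) ` fan_triangles k"
proof -
  define r where "r = residue (n + k) v"
  define A where "A j = r ` insert 0 {1, j, j + 1}" for j
  define B where "B j = r ` insert 0 {- 1, j - 1, j}" for j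
  have shift: "r (z + int (n + k)) = r z" for z by (simp only: r_def residue_shift)
  \<comment> \<open>The last two triangles of \<open>quad\<close> contain negative offsets; adding
    \<open>n + k\<close> to \<open>-l\<close> and its lower or upper neighbour puts them into the
    form \<open>A\<close> and \<open>B\<close> with index \<open>n + k - l\<close>.\<close>
  have AB: "(\<lambda>t. r ` insert 0 t) ` quad 1 (int (l - 1)) 1 =
      {A (int l), B (int l), A (int (n + k) - int l), B (int (n + k) - int l)}" if "h \<le> l" for l
  proof -
    have l1: "int (l - 1) = int l - 1" using that h2 by simp
    have "r ` insert 0 {- int l, 1 - int l, 1} = A (int (n + k) - int l)"
      using shift[of "- int l"] shift[of "1 - int l"] by (simp add: A_def insert_commute algebra_simps)
    moreover have "r ` insert 0 {- int l - 1, - int l, - 1} = B (int (n + k) - int l)"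
      using shift[of "- int l"] shift[of "- int l - 1"] by (simp add: B_def insert_commute algebra_simps)
    ultimately show ?thesis
      unfolding quad_def l1 by (simp add: A_def B_def insert_commute algebra_simps)
  qed
  have "(\<Union>l\<in>{h..(n + k) div 2}. (\<lambda>t. r ` insert 0 t) ` quad 1 (int (l - 1)) 1) =
     (\<Union>l\<in>{h..(n + k) div 2}. {A (int l), B (int l), A (int (n + k) - int l), B (int (n + k) - int l)})"
    using AB by (intro SUP_cong) auto
  also have "\<dots> = (\<Union>j\<in>{int h..int h + int k}. {A j, B j})"
  proof (intro equalityI subsetI)
    fix t assume "t \<in> (\<Union>l\<in>{h..(n + k) div 2}. {A (int l), B (int l), A (int (n + k) - int l), B (int (n + k) - int l)})"
    then obtain l where l: "h \<le> l" "l \<le> (n + k) div 2"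
      "t \<in> {A (int l), B (int l), A (int (n + k) - int l), B (int (n + k) - int l)}" by auto
    have "int l \<in> {int h..int h + int k}" "int (n + k) - int l \<in> {int h..int h + int k}"
      using l n by auto
    then show "t \<in> (\<Union>j\<in>{int h..int h + int k}. {A j, B j})" using l(3) by blast
  next
    fix t assume "t \<in> (\<Union>j\<in>{int h..int h + int k}. {A j, B j})"
    then obtain j where j: "j \<in> {int h..int h + int k}" "t \<in> {A j, B j}" by auto
    show "t \<in> (\<Union>l\<in>{h..(n + k) div 2}. {A (int l), B (int l), A (int (n + k) - int l), B (int (n + k) - int l)})"
    proof (cases "j \<le> int ((n + k) div 2)")
      case True
      then show ?thesis using j by (intro UN_I[of "nat j"]) auto
    next
      case False
      then show ?thesis using j n by (intro UN_I[of "nat (int (n + k) - j)"]) auto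
    qed
  qed
  also have "\<dots> = (\<lambda>t. r ` insert 0 t) ` fan_triangles k"
    unfolding fan_triangles_def A_def B_def by blast
  finally show ?thesis by (simp add: r_def)
qed

lemma tetrahedra_star:
  assumes v: "v < n + k"
  shows "{t \<in> tetrahedra k. v \<in> t} =
     (\<lambda>t. residue (n + k) v ` insert 0 t) ` (old_triangles \<union> fan_triangles k)"
proof -
  let ?f = "\<lambda>t. residue (n + k) v ` insert 0 t"
  have 1: "{t \<in> diff_cycle (ext_cycle d k i). v \<in> t} = ?f ` quad (int (d i 0)) (int (d i 1)) (int (d i 2))"
    if "i \<in> {1..m}" for i
    unfolding ext_cycle_def using dsum[OF that] by (intro diff_cycle_star v) simp
  have 2: "{t \<in> diff_cycle [1, l - 1, 1, n + k - l - 1]. v \<in> t} = ?f ` quad 1 (int (l - 1)) 1"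
    if "l \<in> {h..(n + k) div 2}" for l
  proof -
    have "n + k = 1 + (l - 1) + 1 + (n + k - l - 1)" using that n h2 by auto
    then show ?thesis using diff_cycle_star[OF _ v, of 1 "l - 1" 1 "n + k - l - 1"] by simp
  qed
  have "{t \<in> tetrahedra k. v \<in> t} = (\<Union>i\<in>{1..m}. {t \<in> diff_cycle (ext_cycle d k i). v \<in> t}) \<union>
     (\<Union>l\<in>{h..(n + k) div 2}. {t \<in> diff_cycle [1, l - 1, 1, n + k - l - 1]. v \<in> t})"
    unfolding tetrahedra_def using n by fastforce
  also have "\<dots> = (\<Union>i\<in>{1..m}. ?f ` quad (int (d i 0)) (int (d i 1)) (int (d i 2))) \<union>
     (\<Union>l\<in>{h..(n + k) div 2}. ?f ` quad 1 (int (l - 1)) 1)"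
    using 1 2 by (intro arg_cong2[of _ _ _ _ "(\<union>)"] SUP_cong refl) auto
  also have "\<dots> = ?f ` (old_triangles \<union> fan_triangles k)"
    unfolding fan_star[OF v] old_triangles_def by blast
  finally show ?thesis .
qed

text \<open>The representative modulo \<open>n + k = 2 h + k\<close> in \<open>{-h..<h + k}\<close>.\<close>

definition window :: "nat \<Rightarrow> int \<Rightarrow> int" where
  "window k z = (z + int h) mod int (n + k) - int h"

definition link_triangles :: "nat \<Rightarrow> int set set" where
  "link_triangles k = (`) (window k) ` (old_triangles \<union> fan_triangles k)"

lemma N0: "n + k > 0" using n h2 by simp

lemma residue_window: "residue (n + k) v (window k z) = residue (n + k) v z"
proof -
  have "(int v + window k z) mod int (n + k) = (int v - int h + (z + int h) mod int (n + k)) mod int (n + k)"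
    by (simp add: window_def algebra_simps)
  also have "\<dots> = (int v + z) mod int (n + k)"
    unfolding mod_add_right_eq by (simp add: algebra_simps)
  finally show ?thesis using N0[of k] by (simp only: residue_eq_iff)
qed

lemma window_id: "- int h \<le> z \<Longrightarrow> z < int h + int k \<Longrightarrow> window k z = z"
  unfolding window_def using n by (subst mod_pos_pos_trivial) auto

lemma window_range: "- int h \<le> window k z" "window k z < int h + int k"
  using N0[of k] pos_mod_bound[of "int (n + k)" "z + int h"] pos_mod_sign[of "int (n + k)" "z + int h"] n
  unfolding window_def by auto

lemma inj_on_residue:
  assumes "\<And>x y. x \<in> A \<Longrightarrow> y \<in> A \<Longrightarrow> x - y < int (n + k)"
  shows "inj_on (residue (n + k) v) A"
proof (rule inj_onI)
  fix x y assume xy: "x \<in> A" "y \<in> A" "residue (n + k) v x = residue (n + k) v y"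
  then have "(int v + x) mod int (n + k) = (int v + y) mod int (n + k)"
    using N0 by (simp add: residue_eq_iff)
  then have "int (n + k) dvd (int v + x) - (int v + y)" by (simp add: mod_eq_dvd_iff)
  then have "int (n + k) dvd x - y" by simp
  moreover have "\<bar>x - y\<bar> < int (n + k)" using assms[of x y] assms[of y x] xy by auto
  ultimately show "x = y" using zdvd_imp_le[of "int (n + k)" "\<bar>x - y\<bar>"] by fastforce
qed

text \<open>The offsets of a tetrahedron spread over less than \<open>n + k\<close>: by at most
  \<open>d i 0 + d i 1 + d i 2\<close> for the old ones and by at most \<open>h + k + 1\<close> for
  the fan, where \<open>h2\<close> gives the strict inequality. Hence no two vertices coincide
  modulo \<open>n + k\<close>.\<close>

lemma triangle_facts:
  assumes "t \<in> old_triangles \<union> fan_triangles k"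
  shows "card t = 3" "0 \<notin> t" "inj_on (residue (n + k) v) (insert 0 t)"
proof -
  have "card t = 3 \<and> 0 \<notin> t \<and> (\<forall>x\<in>insert 0 t. \<forall>y\<in>insert 0 t. x - y < int (n + k))"
    using assms
  proof
    assume "t \<in> old_triangles"
    then obtain i where i: "i \<in> {1..m}" "t \<in> quad (int (d i 0)) (int (d i 1)) (int (d i 2))"
      by (auto simp: old_triangles_def)
    have "0 < d i 0" "0 < d i 1" "0 < d i 2" "0 < d i 3" using dpos[OF i(1)] by auto
    moreover note dsum[OF i(1)]
    ultimately show ?thesis using i(2) unfolding quad_def
      by (elim insertE emptyE) (auto simp: card_insert_if)
  next
    assume "t \<in> fan_triangles k"
    then obtain j where "int h \<le> j" "j \<le> int h + int k" "t = {1, j, j + 1} \<or> t = {- 1, j - 1, j}"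
      by (auto simp: fan_triangles_def)
    then show ?thesis using n h2 by (elim disjE) (auto simp: card_insert_if)
  qed
  then show "card t = 3" "0 \<notin> t" "inj_on (residue (n + k) v) (insert 0 t)"
    by (blast, blast, intro inj_on_residue) blast
qed

lemma link_ext_cplx:
  assumes v: "v < n + k"
  shows "cplx_link (ext_cplx n m d k) v = faces ((`) (residue (n + k) v) ` link_triangles k)"
proof -
  define r where "r = residue (n + k) v"
  define E where "E = old_triangles \<union> fan_triangles k"
  have r0: "r 0 = v" using v by (simp add: r_def residue_0)
  have star: "t \<in> tetrahedra k \<and> v \<in> t \<longleftrightarrow> (\<exists>e\<in>E. t = insert v (r ` e))" for t
  proof -
    have "t \<in> tetrahedra k \<and> v \<in> t \<longleftrightarrow> t \<in> {t \<in> tetrahedra k. v \<in> t}" by simp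
    also have "\<dots> \<longleftrightarrow> t \<in> (\<lambda>e. r ` insert 0 e) ` E" unfolding tetrahedra_star[OF v] r_def E_def by (rule refl)
    also have "\<dots> \<longleftrightarrow> (\<exists>e\<in>E. t = insert v (r ` e))" by (simp add: image_iff r0)
    finally show ?thesis .
  qed
  have vr: "v \<notin> r ` e" if "e \<in> E" for e
  proof -
    have "0 \<notin> e" "inj_on r (insert 0 e)"
      using triangle_facts(2)[of e k] triangle_facts(3)[of e k v] that unfolding E_def r_def by auto
    then show ?thesis using r0 by (auto simp: inj_on_def)
  qed
  have "cplx_link (faces (tetrahedra k)) v = faces ((`) r ` E)"
  proof (intro equalityI subsetI)
    fix s assume s: "s \<in> cplx_link (faces (tetrahedra k)) v"
    then have s': "v \<notin> s" "s \<noteq> {}" "\<exists>t\<in>tetrahedra k. insert v s \<subseteq> t"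
      unfolding cplx_link_def faces_def by simp_all
    then obtain t where t: "t \<in> tetrahedra k" "insert v s \<subseteq> t" by blast
    then obtain e where e: "e \<in> E" "t = insert v (r ` e)" using star[of t] by auto
    then have "s \<subseteq> r ` e" using t s' by auto
    then show "s \<in> faces ((`) r ` E)" using e s' by (auto simp: faces_def)
  next
    fix s assume s: "s \<in> faces ((`) r ` E)"
    then obtain e where e: "e \<in> E" "s \<subseteq> r ` e" "s \<noteq> {}" by (auto simp: faces_def)
    then have "v \<notin> s" using vr by auto
    moreover have "insert v (r ` e) \<in> tetrahedra k" using star e(1) by blast
    then have "\<exists>t\<in>tetrahedra k. s \<subseteq> t" "\<exists>t\<in>tetrahedra k. insert v s \<subseteq> t"
      using e(2) by (intro bexI[of _ "insert v (r ` e)"]; auto)+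
    ultimately show "s \<in> cplx_link (faces (tetrahedra k)) v"
      using e(3) by (simp add: cplx_link_def faces_def)
  qed
  moreover have "(`) r ` link_triangles k = (`) r ` E"
    unfolding link_triangles_def E_def[symmetric] image_image r_def residue_window ..
  ultimately show ?thesis by (simp add: ext_cplx_eq r_def)
qed

lemma finite_link_triangles: "finite (link_triangles k)"
  by (auto simp: link_triangles_def old_triangles_def fan_triangles_def quad_def)

lemma link_triangles_facts:
  assumes "t \<in> link_triangles k"
  shows "card t = 3" "t \<subseteq> {- int h..<int h + int k}"
proof -
  obtain e where e: "e \<in> old_triangles \<union> fan_triangles k" "t = window k ` e"
    using assms by (auto simp: link_triangles_def)
  show "t \<subseteq> {- int h..<int h + int k}" using e(2) window_range by auto
  \<comment> \<open>Passing to the window does not change residues, so injectivity of the reduction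
    is inherited by \<open>window\<close> itself.\<close>
  have "inj_on (residue (n + k) 0 \<circ> window k) e"
    using triangle_facts(3)[OF e(1), of 0] by (auto simp: inj_on_def residue_window)
  then have "inj_on (window k) e" by (rule inj_on_imageI2)
  then show "card t = 3" using triangle_facts(1)[OF e(1)] e(2) by (simp add: card_image)
qed

lemma inj_on_residue_link: "inj_on (residue (n + k) v) (\<Union>(link_triangles k))"
proof (rule inj_on_residue)
  fix x y assume "x \<in> \<Union>(link_triangles k)" "y \<in> \<Union>(link_triangles k)"
  then have "x \<in> {- int h..<int h + int k}" "y \<in> {- int h..<int h + int k}"
    using link_triangles_facts(2) by blast+
  then show "x - y < int (n + k)" using n by auto
qed

lemma tetrahedra_lt: "t \<in> tetrahedra k \<Longrightarrow> x \<in> t \<Longrightarrow> x < n + k"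
proof -
  assume t: "t \<in> tetrahedra k" "x \<in> t"
  then obtain a where a: "t \<in> diff_cycle a" "a \<in> ext_cycle d k ` {1..m} \<union>
       {[1, l - 1, 1, n + k - l - 1] | l. n div 2 \<le> l \<and> l \<le> (n + k) div 2}"
    unfolding tetrahedra_def by blast
  have "sum_list a = n + k"
    using a(2)
  proof
    assume "a \<in> ext_cycle d k ` {1..m}"
    then show ?thesis using dsum by (fastforce simp: ext_cycle_def)
  next
    assume "a \<in> {[1, l - 1, 1, n + k - l - 1] | l. n div 2 \<le> l \<and> l \<le> (n + k) div 2}"
    then show ?thesis using n h2 by auto
  qed
  then show ?thesis using a(1) t(2) N0[of k] unfolding diff_cycle_def by auto
qed

lemma tetrahedra_card:
  assumes "t \<in> tetrahedra k" shows "card t = 4" "finite t"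
proof -
  obtain v where v: "v \<in> t"
    using assms unfolding tetrahedra_def diff_cycle_def ext_cycle_def by fastforce
  then have "v < n + k" using tetrahedra_lt assms by blast
  then obtain e where e: "e \<in> old_triangles \<union> fan_triangles k" "t = residue (n + k) v ` insert 0 e"
    using tetrahedra_star[of v k] assms v by blast
  have "card (insert 0 e) = 4" "finite e"
  proof -
    show "finite e" using triangle_facts(1)[OF e(1)] by (intro card_ge_0_finite) simp
    then show "card (insert 0 e) = 4" using triangle_facts(1,2)[OF e(1)] by (simp add: card_insert_if)
  qed
  then show "card t = 4" "finite t" using card_image[OF triangle_facts(3)[OF e(1), of v]] e(2) by simp_all
qed

lemma vertices_ext_cplx: "cplx_vertices (ext_cplx n m d k) = {..<n + k}"
proof (intro equalityI subsetI)
  fix v assume "v \<in> cplx_vertices (ext_cplx n m d k)"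
  then show "v \<in> {..<n + k}" using tetrahedra_lt by (auto simp: ext_cplx_eq faces_def)
next
  fix v assume "v \<in> {..<n + k}"
  then have v: "v < n + k" by simp
  have "{1, int h, int h + 1} \<in> fan_triangles k" by (auto simp: fan_triangles_def)
  then have "{t \<in> tetrahedra k. v \<in> t} \<noteq> {}" unfolding tetrahedra_star[OF v] by auto
  then obtain t where "t \<in> tetrahedra k" "v \<in> t" by auto
  then have "{v} \<in> faces (tetrahedra k)" by (auto simp: faces_def)
  then show "v \<in> cplx_vertices (ext_cplx n m d k)" unfolding ext_cplx_eq by blast
qed

lemma simplicial_cplx_faces:
  assumes "finite F" "\<And>t. t \<in> F \<Longrightarrow> finite t"
  shows "simplicial_cplx (faces F)"
proof -
  have "faces F \<subseteq> (\<Union>t\<in>F. Pow t)" by (auto simp: faces_def)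
  moreover have "finite (\<Union>t\<in>F. Pow t)" using assms by auto
  ultimately have "finite (faces F)" by (rule finite_subset)
  moreover have "t \<in> faces F" if "s \<in> faces F" "t \<subseteq> s" "t \<noteq> {}" for s t
    using that unfolding faces_def by blast
  moreover have "finite s \<and> s \<noteq> {}" if "s \<in> faces F" for s
    using that assms by (auto simp: faces_def intro: finite_subset)
  ultimately show ?thesis unfolding simplicial_cplx_def by blast
qed

text \<open>The links at all vertices are relabellings of the one integer model, while finiteness
  and purity hold for every \<open>k\<close>; a single sphere condition remains.\<close>

lemma manifold_iff_link_sphere:
  "combinatorial_3_manifold (ext_cplx n m d k) \<longleftrightarrow> is_triangulated_sphere (link_triangles k)"
proof -
  have "tetrahedra k \<subseteq> Pow {..<n + k}" using tetrahedra_lt by auto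
  then have finT: "finite (tetrahedra k)" by (rule finite_subset) simp
  then have simp: "simplicial_cplx (ext_cplx n m d k)"
    unfolding ext_cplx_eq by (intro simplicial_cplx_faces tetrahedra_card(2))
  have pure: "pure_cplx 3 (ext_cplx n m d k)"
    unfolding pure_cplx_def
  proof (intro conjI ballI)
    have "0 \<in> cplx_vertices (ext_cplx n m d k)" using vertices_ext_cplx N0[of k] by simp
    then show "ext_cplx n m d k \<noteq> {}" by auto
    fix s assume s: "s \<in> cplx_facets (ext_cplx n m d k)"
    then obtain t where t: "t \<in> tetrahedra k" "s \<subseteq> t" by (auto simp: cplx_facets_def ext_cplx_eq faces_def)
    then have "t \<noteq> {}" using tetrahedra_card(1) by fastforce
    then have "t \<in> faces (tetrahedra k)" using t by (auto simp: faces_def)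
    then have "t = s" using s t by (auto simp: cplx_facets_def ext_cplx_eq)
    then show "card s = 3 + 1" using tetrahedra_card t by simp
  qed
  have fin: "finite t" if "t \<in> link_triangles k" for t
    using link_triangles_facts(1)[OF that] by (auto intro: card_ge_0_finite)
  have hom: "geom_realization (faces (link_triangles k)) homeomorphic
      geom_realization (faces ((`) (residue (n + k) v) ` link_triangles k))" for v
    by (intro homeomorphic_relabel fin inj_on_residue_link)
  have "triangulated_2_sphere (cplx_link (ext_cplx n m d k) v) \<longleftrightarrow> is_triangulated_sphere (link_triangles k)"
    if v: "v < n + k" for v
  proof -
    have "simplicial_cplx (faces ((`) (residue (n + k) v) ` link_triangles k))"
      using finite_link_triangles fin by (intro simplicial_cplx_faces) auto
    then show ?thesis
      unfolding triangulated_2_sphere_def link_ext_cplx[OF v]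
      using homeomorphic_trans[OF hom[of v]] homeomorphic_trans[OF homeomorphic_sym[THEN iffD1, OF hom[of v]]]
      by blast
  qed
  then show ?thesis
    using simp pure N0[of k] unfolding combinatorial_3_manifold_def vertices_ext_cplx by auto
qed

end

section \<open>Cycles that are too long are excluded\<close>

context cyclic_family begin

lemma link_trianglesI:
  assumes "t \<in> old_triangles \<union> fan_triangles k" "t \<subseteq> {- int h..<int h + int k}"
  shows "t \<in> link_triangles k"
proof -
  have "window k ` t = (\<lambda>z. z) ` t"
    using assms(2) by (intro image_cong refl window_id) auto
  then have "window k ` t = t" by simp
  then show ?thesis using assms(1) unfolding link_triangles_def by (metis imageI)
qed

text \<open>If \<open>s > h\<close>, the fan triangles contribute the closed 4-cycle \<open>1, s + 1, -1, s - 1\<close> to the link of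
  the vertex \<open>s\<close>, so this link, being a connected cycle, contains nothing else.\<close>

lemma long_cycle_in_fan:
  assumes sph: "is_triangulated_sphere (link_triangles n)"
    and i: "i \<in> {1..m}" and s: "h < d i 0 + d i 1 + d i 2"
  shows "d i 0 = 1" "d i 2 = 1"
proof -
  define s where "s = int (d i 0 + d i 1 + d i 2)"
  define F where "F = link_triangles n"
  have pos: "0 < d i 0" "0 < d i 1" "0 < d i 2" "0 < d i 3" using dpos[OF i] by auto
  have sn: "int h < s" "s + 1 \<le> 2 * int h" using s dsum[OF i] pos n by (auto simp: s_def)
  have F3: "\<And>t. t \<in> F \<Longrightarrow> card t = 3" unfolding F_def by (rule link_triangles_facts)
  have sphF: "is_triangulated_sphere F" using sph by (simp add: F_def)
  \<comment> \<open>For \<open>k = n\<close> the window reaches up to \<open>3 h - 1\<close>, beyond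
    every index occurring around \<open>s\<close>, so these fan triangles appear unreduced.\<close>
  have fanI: "{1, j, j + 1} \<in> F" "{- 1, j - 1, j} \<in> F" if "int h \<le> j" "j + 1 \<le> 2 * int h + 1" for j
  proof -
    have "{1, j, j + 1} \<in> fan_triangles n" "{- 1, j - 1, j} \<in> fan_triangles n"
      using that h2 n by (auto simp: fan_triangles_def)
    moreover have "{1, j, j + 1} \<subseteq> {- int h..<int h + int n}" "{- 1, j - 1, j} \<subseteq> {- int h..<int h + int n}"
      using that h2 n by auto
    ultimately show "{1, j, j + 1} \<in> F" "{- 1, j - 1, j} \<in> F"
      unfolding F_def using link_trianglesI by blast+
  qed
  \<comment> \<open>Fan indices \<open>s\<close>, \<open>s\<close>, \<open>s - 1\<close> and
    \<open>s + 1\<close>; the lower bound \<open>s > h\<close> is what makes \<open>s - 1\<close> an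
    admissible index.\<close>
  have t: "{s, 1, s + 1} \<in> F" "{s, - 1, s - 1} \<in> F" "{s, 1, s - 1} \<in> F" "{s, - 1, s + 1} \<in> F"
    using fanI(1)[of s] fanI(2)[of s] fanI(1)[of "s - 1"] fanI(2)[of "s + 1"] sn
    by (simp_all add: insert_commute)
  have two: "u = z1 \<or> u = z2" if "{s, y, z1} \<in> F" "{s, y, z2} \<in> F" "z1 \<noteq> z2" "{s, y, u} \<in> F" for y z1 z2 u
    using triangulated_sphere_edge_not_in_three_triangles[OF sphF F3 that(1,2,4,3)] by blast
  define P where "P = {1, - 1, s + 1, s - 1}"
  have closed: "z \<in> P" if yz: "{s, y, z} \<in> F" "y \<in> P" for y z
  proof -
    consider "y = 1" | "y = - 1" | "y = s + 1" | "y = s - 1" using yz(2) by (auto simp: P_def)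
    then show ?thesis
    proof cases
      case 1
      then show ?thesis using two[OF t(1) t(3), of z] yz(1) by (auto simp: P_def)
    next
      case 2
      then show ?thesis using two[OF t(2) t(4), of z] yz(1) by (auto simp: P_def)
    next
      case 3
      then show ?thesis using two[of "s + 1" 1 "- 1" z] t yz(1) by (auto simp: P_def insert_commute)
    next
      case 4
      then show ?thesis using two[of "s - 1" 1 "- 1" z] t yz(1) by (auto simp: P_def insert_commute)
    qed
  qed
  define a where "a = int (d i 0)"
  define b where "b = int (d i 0) + int (d i 1)"
  have "{a, b, s} \<in> old_triangles"
    using i by (auto simp: old_triangles_def quad_def a_def b_def s_def)
  moreover have "{a, b, s} \<subseteq> {- int h..<int h + int n}"
    using pos sn n h2 by (auto simp: a_def b_def s_def)
  ultimately have "{a, b, s} \<in> F" unfolding F_def by (intro link_trianglesI) auto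
  then have "{s, a, b} \<in> F" "{s, b, a} \<in> F" by (simp_all add: insert_commute)
  then have "a \<in> P" "b \<in> P"
    using triangulated_sphere_link_connected[OF sphF F3 closed t(1)] by (auto simp: P_def)
  \<comment> \<open>Of the four members of \<open>P\<close>, only \<open>1\<close> and
    \<open>s - 1\<close> lie strictly between \<open>0\<close> and \<open>s\<close>, and
    \<open>a\<close> is the smaller of the two numbers in question.\<close>
  moreover have "1 \<le> a" "a < b" "b < s" using pos by (auto simp: a_def b_def s_def)
  ultimately have "a = 1" "b = s - 1" by (auto simp: P_def)
  then show "d i 0 = 1" "d i 2 = 1" by (auto simp: a_def b_def s_def)
qed

end

section \<open>Explicit vertex links when all cycles are short\<close>

locale short_cyclic_family = cyclic_family +
  assumes short: "\<And>i. i \<in> {1..m} \<Longrightarrow> d i 0 + d i 1 + d i 2 \<le> h"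
begin

text \<open>Only the first triangle of \<open>quad\<close> contains the full sum of the three
  entries, and only the last contains its negative; the former is entirely positive, the latter
  entirely negative. This sign separation keeps the triangles at \<open>h\<close> and at
  \<open>-h\<close> apart.\<close>

lemma old_triangle_bounds:
  assumes "t \<in> old_triangles"
  shows "x \<in> t \<Longrightarrow> - int h \<le> x" "x \<in> t \<Longrightarrow> x \<le> int h"
    and "- int h \<in> t \<Longrightarrow> x \<in> t \<Longrightarrow> x < 0" "int h \<in> t \<Longrightarrow> x \<in> t \<Longrightarrow> 0 < x"
proof -
  obtain i where i: "i \<in> {1..m}" "t \<in> quad (int (d i 0)) (int (d i 1)) (int (d i 2))"
    using assms by (auto simp: old_triangles_def)
  have "0 < d i 0" "0 < d i 1" "0 < d i 2" using dpos[OF i(1)] by auto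
  moreover note short[OF i(1)]
  ultimately show "x \<in> t \<Longrightarrow> - int h \<le> x" "x \<in> t \<Longrightarrow> x \<le> int h"
    "- int h \<in> t \<Longrightarrow> x \<in> t \<Longrightarrow> x < 0" "int h \<in> t \<Longrightarrow> x \<in> t \<Longrightarrow> 0 < x"
    using i(2) unfolding quad_def by (elim insertE emptyE; force)+
qed

lemma old_triangle_facts: "t \<in> old_triangles \<Longrightarrow> card t = 3" "t \<in> old_triangles \<Longrightarrow> finite t"
proof -
  assume "t \<in> old_triangles"
  then show "card t = 3" using triangle_facts(1)[of t 0] by simp
  then show "finite t" by (intro card_ge_0_finite) simp
qed

lemma window_wrap: "window k (int h + int k) = - int h" "window k (int h + int k + 1) = 1 - int h"
proof -
  have shift: "window k (z + int (n + k)) = window k z" for z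
  proof -
    have "z + int (n + k) + int h = (z + int h) + int (n + k)" by simp
    then show ?thesis by (simp only: window_def mod_add_self2)
  qed
  have "window k (- int h + int (n + k)) = - int h" "window k (1 - int h + int (n + k)) = 1 - int h"
    unfolding shift using h2 by (auto intro!: window_id)
  then show "window k (int h + int k) = - int h" "window k (int h + int k + 1) = 1 - int h"
    using n by (simp_all add: algebra_simps)
qed

text \<open>The part of the link that is the same for all positive \<open>k\<close>: besides the old
  triangles, the two extreme triangles of the fan, the upper one already wrapped to the bottom of
  the window.\<close>

definition base_triangles :: "int set set" where
  "base_triangles = old_triangles \<union> {{1, - int h, 1 - int h}, {- 1, int h - 1, int h}}"

text \<open>Outside \<open>base_triangles\<close> the link is the join of the two points
  \<open>1\<close> and \<open>-1\<close> with the path \<open>h, h + 1, ..., h + k, -h\<close>. Only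
  the last edge of this path wraps around, so raising \<open>k\<close> just lengthens the
  path.\<close>

lemma link_triangles_Suc:
  "link_triangles (Suc k) = base_triangles \<union> {{x, j, j + 1} | x j. x \<in> {1, - 1} \<and> int h \<le> j \<and> j < int h + int k}
     \<union> {{x, int h + int k, - int h} | x. x \<in> {1, - 1}}" (is "_ = ?R")
proof (intro equalityI subsetI)
  note wrap = window_wrap[of "Suc k"]
  have old: "window (Suc k) ` t = t" if t: "t \<in> old_triangles" for t
  proof -
    have "window (Suc k) x = x" if "x \<in> t" for x
      using old_triangle_bounds(1,2)[OF t that] by (intro window_id) auto
    then show ?thesis by (metis (no_types, lifting) image_cong image_ident)
  qed
  {
    fix t assume "t \<in> link_triangles (Suc k)"
    then obtain e where e: "e \<in> old_triangles \<union> fan_triangles (Suc k)" "t = window (Suc k) ` e"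
      by (auto simp: link_triangles_def)
    from e(1) show "t \<in> ?R"
    proof
      assume "e \<in> old_triangles"
      then show ?thesis using e(2) old by (simp add: base_triangles_def)
    next
      assume "e \<in> fan_triangles (Suc k)"
      then obtain j where j: "int h \<le> j" "j \<le> int h + int k + 1" "e = {1, j, j + 1} \<or> e = {- 1, j - 1, j}"
        by (auto simp: fan_triangles_def)
      have w1: "window (Suc k) 1 = 1" "window (Suc k) (- 1) = - 1" using h2 by (auto intro!: window_id)
      from j(3) show ?thesis
      proof
        assume e1: "e = {1, j, j + 1}"
        consider "j < int h + int k" | "j = int h + int k" | "j = int h + int k + 1" using j by linarith
        then show ?thesis
        proof cases
          case 1
          then have "t = {1, j, j + 1}" using e(2) e1 w1 j(1) by (simp add: window_id)
          then show ?thesis using 1 j(1) by blast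
        next
          case 2
          then have "t = {1, int h + int k, - int h}" using e(2) e1 w1 wrap by (simp add: window_id algebra_simps)
          then show ?thesis by blast
        next
          case 3
          then have "window (Suc k) j = - int h" "window (Suc k) (j + 1) = 1 - int h"
            using wrap by (simp_all add: algebra_simps)
          then have "t = {1, - int h, 1 - int h}" using e(2) e1 w1 by simp
          then show ?thesis by (simp add: base_triangles_def)
        qed
      next
        assume e1: "e = {- 1, j - 1, j}"
        consider "j = int h" | "int h < j" "j \<le> int h + int k" | "j = int h + int k + 1" using j by linarith
        then show ?thesis
        proof cases
          case 1
          then have "t = {- 1, int h - 1, int h}" using e(2) e1 w1 h2 by (simp add: window_id)
          then show ?thesis by (simp add: base_triangles_def)
        next
          \<comment> \<open>Fan triangles at \<open>-1\<close> are indexed by the upper end of their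
            path edge, hence the shift by one.\<close>
          case 2
          then have "t = {- 1, j - 1, (j - 1) + 1}" using e(2) e1 w1 by (simp add: window_id)
          moreover have "int h \<le> j - 1" "j - 1 < int h + int k" using 2 by auto
          ultimately show ?thesis by blast
        next
          case 3
          then have "t = {- 1, int h + int k, - int h}" using e(2) e1 w1 wrap by (simp add: window_id algebra_simps)
          then show ?thesis by blast
        qed
      qed
    qed
  next
    fix t assume tR: "t \<in> ?R"
    consider "t \<in> old_triangles" | "t = {1, - int h, 1 - int h}" | "t = {- 1, int h - 1, int h}"
      | j where "int h \<le> j" "j < int h + int k" "t = {1, j, j + 1} \<or> t = {- 1, j, j + 1}"
      | "t = {1, int h + int k, - int h}" | "t = {- 1, int h + int k, - int h}"
    proof -
      from tR consider "t \<in> base_triangles"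
        | x j where "x \<in> {1, - 1}" "int h \<le> j" "j < int h + int k" "t = {x, j, j + 1}"
        | x where "x \<in> {1, - 1}" "t = {x, int h + int k, - int h}"
        by blast
      then show thesis
      proof cases
        case 1
        then show thesis unfolding base_triangles_def using that(1-3) by blast
      next
        case (2 x j)
        then show thesis using that(4)[of j] by auto
      next
        case (3 x)
        then show thesis using that(5,6) by auto
      qed
    qed
    then show "t \<in> link_triangles (Suc k)"
    proof cases
      case 1
      then show ?thesis using old unfolding link_triangles_def by (metis UnI1 imageI)
    next
      case 2
      define j where "j = int h + int k + 1"
      have "window (Suc k) j = - int h" "window (Suc k) (j + 1) = 1 - int h" "window (Suc k) 1 = 1"
        using wrap h2 by (simp_all add: j_def algebra_simps window_id)
      then have "window (Suc k) ` {1, j, j + 1} = t" by (simp add: 2)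
      moreover have "{1, j, j + 1} \<in> fan_triangles (Suc k)"
        by (auto simp: fan_triangles_def j_def)
      ultimately show ?thesis unfolding link_triangles_def by blast
    next
      case 3
      have "t \<in> fan_triangles (Suc k)" by (auto simp: fan_triangles_def 3)
      then show ?thesis using 3 h2 by (intro link_trianglesI) auto
    next
      case (4 j)
      have "{1, j, j + 1} \<in> fan_triangles (Suc k)" "{- 1, (j + 1) - 1, j + 1} \<in> fan_triangles (Suc k)"
        unfolding fan_triangles_def using 4 by (intro UN_I[of j] UN_I[of "j + 1"]; simp)+
      then have t: "t \<in> old_triangles \<union> fan_triangles (Suc k)" using 4(3) by auto
      have "{1, j, j + 1} \<subseteq> {- int h..<int h + int (Suc k)}" "{- 1, j, j + 1} \<subseteq> {- int h..<int h + int (Suc k)}"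
        using 4(1,2) h2 by auto
      then show ?thesis using t 4(3) link_trianglesI by blast
    next
      case 5
      have "window (Suc k) ` {1, int h + int k, int h + int k + 1} = t"
        using wrap h2 by (simp add: 5 window_id algebra_simps)
      moreover have "{1, int h + int k, int h + int k + 1} \<in> fan_triangles (Suc k)"
        by (auto simp: fan_triangles_def)
      ultimately show ?thesis unfolding link_triangles_def by blast
    next
      case 6
      have "window (Suc k) ` {- 1, int h + int k + 1 - 1, int h + int k + 1} = t"
        using wrap h2 by (simp add: 6 window_id algebra_simps)
      moreover have "{- 1, int h + int k + 1 - 1, int h + int k + 1} \<in> fan_triangles (Suc k)"
        unfolding fan_triangles_def by (intro UN_I[of "int h + int k + 1"]) auto
      ultimately show ?thesis unfolding link_triangles_def by blast
    qed
  }
qed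

text \<open>Increasing \<open>k\<close> to \<open>k + 1 \<ge> 2\<close> subdivides one edge of the vertex link.\<close>

lemma homeomorphic_link_Suc:
  "geom_realization (faces (link_triangles (Suc k))) homeomorphic
   geom_realization (faces (link_triangles (Suc (Suc k))))"
proof (rule homeomorphic_bistellar)
  \<comment> \<open>For \<open>Suc k\<close> the last path vertex before the wrap to
    \<open>-h\<close> is \<open>h + k\<close>, and \<open>u + 1\<close> is the vertex gained by the
    next window.\<close>
  define u where "u = int h + int k"
  define H where "H = int h"
  have H: "2 \<le> H" "H \<le> u" using h2 by (auto simp: H_def u_def)
  have fin: "finite t" if "t \<in> link_triangles k'" for k' t
    using link_triangles_facts(1)[OF that] by (intro card_ge_0_finite) simp
  have F: "link_triangles (Suc k) = base_triangles \<union> {{x, j, j + 1} | x j. x \<in> {1, - 1} \<and> H \<le> j \<and> j < u}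
     \<union> {{x, u, - H} | x. x \<in> {1, - 1}}"
    unfolding link_triangles_Suc by (simp add: H_def u_def)
  have F': "link_triangles (Suc (Suc k)) = base_triangles \<union> {{x, j, j + 1} | x j. x \<in> {1, - 1} \<and> H \<le> j \<and> j < u + 1}
     \<union> {{x, u + 1, - H} | x. x \<in> {1, - 1}}"
    unfolding link_triangles_Suc[of "Suc k"] by (simp add: H_def u_def algebra_simps)
  \<comment> \<open>An old triangle containing \<open>-h\<close> is entirely negative, so the edge
    to be subdivided occurs only in the two triangles with apex \<open>1\<close> or
    \<open>-1\<close>.\<close>
  have base: "\<not> {u, - H} \<subseteq> t" "u + 1 \<notin> t" if "t \<in> base_triangles" for t
  proof -
    from that consider "t \<in> old_triangles" | "t = {1, - H, 1 - H}" | "t = {- 1, H - 1, H}"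
      by (auto simp: base_triangles_def H_def)
    then have "\<not> {u, - H} \<subseteq> t \<and> u + 1 \<notin> t"
    proof cases
      case 1
      then show ?thesis
        using old_triangle_bounds(2,3)[OF 1, of u] old_triangle_bounds(2)[OF 1, of "u + 1"] H by (auto simp: H_def)
    qed (use H in auto)
    then show "\<not> {u, - H} \<subseteq> t" "u + 1 \<notin> t" by auto
  qed
  show "{u, - H} \<inter> {u + 1} = {}" using H by auto
  show "bistellar_compatible {u, - H} {u + 1} (link_triangles (Suc k)) (link_triangles (Suc (Suc k)))"
  proof (rule bistellar_compatibleI)
    fix t assume t: "t \<in> link_triangles (Suc k)"
    then show "finite t" by (rule fin)
    have "t \<subseteq> {- H..<u + 1}" using link_triangles_facts(2)[OF t] by (simp add: H_def u_def algebra_simps)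
    then show "\<not> {u + 1} \<subseteq> t" by auto
    show "\<exists>t'\<in>link_triangles (Suc (Suc k)). t \<subseteq> t'" if n: "\<not> {u, - H} \<subseteq> t"
    proof -
      consider "t \<in> base_triangles" | x j where "x \<in> {1, - 1}" "H \<le> j" "j < u" "t = {x, j, j + 1}"
        using t n unfolding F by blast
      then have "t \<in> link_triangles (Suc (Suc k))"
      proof cases
        case 2
        then have "j < u + 1" by simp
        then show ?thesis using 2 unfolding F' by blast
      qed (simp add: F')
      then show ?thesis by blast
    qed
    show "\<exists>t'\<in>link_triangles (Suc (Suc k)). (t - {y}) \<union> {u + 1} \<subseteq> t'"
      if S: "{u, - H} \<subseteq> t" and y: "y \<in> {u, - H}" for y
    proof -
      have "\<not> {u, - H} \<subseteq> {x, j, j + 1}" if "x \<in> {1, - 1}" "H \<le> j" "j < u" for x j using that H by auto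
      then obtain x where x: "x \<in> {1, - 1}" "t = {x, u, - H}"
        using t S base(1) unfolding F by blast
      have "{x, u, u + 1} \<in> link_triangles (Suc (Suc k))" "{x, u + 1, - H} \<in> link_triangles (Suc (Suc k))"
        unfolding F' using x(1) H by auto
      moreover have "t - {y} \<union> {u + 1} \<subseteq> {x, u, u + 1} \<or> t - {y} \<union> {u + 1} \<subseteq> {x, u + 1, - H}"
        using x(2) y by auto
      ultimately show ?thesis by blast
    qed
  qed
  show "bistellar_compatible {u + 1} {u, - H} (link_triangles (Suc (Suc k))) (link_triangles (Suc k))"
  proof (rule bistellar_compatibleI)
    fix t assume t: "t \<in> link_triangles (Suc (Suc k))"
    then show "finite t" by (rule fin)
    have 1: "\<not> {u, - H} \<subseteq> {x, j, j + 1}" if "x \<in> {1, - 1}" "H \<le> j" for x j using that H by auto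
    have 2: "\<not> {u, - H} \<subseteq> {x, u + 1, - H}" if "x \<in> {1, - 1}" for x using that H by auto
    show "\<not> {u, - H} \<subseteq> t" using t base(1) 1 2 unfolding F' by blast
    show "\<exists>t'\<in>link_triangles (Suc k). t \<subseteq> t'" if n: "\<not> {u + 1} \<subseteq> t"
    proof -
      consider "t \<in> base_triangles" | x j where "x \<in> {1, - 1}" "H \<le> j" "j < u + 1" "t = {x, j, j + 1}"
        using t n unfolding F' by blast
      then have "t \<in> link_triangles (Suc k)"
      proof cases
        case 2
        then have "j \<noteq> u" using n by auto
        then have "j < u" using 2 by simp
        then show ?thesis using 2 unfolding F by blast
      qed (simp add: F)
      then show ?thesis by blast
    qed
    show "\<exists>t'\<in>link_triangles (Suc k). (t - {y}) \<union> {u, - H} \<subseteq> t'" if S: "{u + 1} \<subseteq> t" and y: "y \<in> {u + 1}" for y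
    proof -
      have "j = u" if "x \<in> {1, - 1}" "H \<le> j" "j < u + 1" "u + 1 \<in> {x, j, j + 1}" for x j using that H by auto
      then obtain x where x: "x \<in> {1, - 1}" "t = {x, u, u + 1} \<or> t = {x, u + 1, - H}"
        using t S base(2) unfolding F' by blast
      have "{x, u, - H} \<in> link_triangles (Suc k)" unfolding F using x(1) by auto
      moreover have "t - {y} \<union> {u, - H} \<subseteq> {x, u, - H}" using x(2) y by auto
      ultimately show ?thesis by blast
    qed
  qed
qed auto

text \<open>For \<open>k = 0\<close> the window ends at \<open>h - 1\<close>, so the only offset of
  an old triangle that is renamed is \<open>h\<close>, which becomes \<open>-h\<close>.\<close>

lemma link_triangles_0:
  "link_triangles 0 = {t \<in> old_triangles. int h \<notin> t} \<union> {{1, - int h, 1 - int h}, {- 1, int h - 1, - int h}} \<union>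
     (\<lambda>t. insert (- int h) (t - {int h})) ` {t \<in> old_triangles. int h \<in> t}"
proof -
  have wH: "window 0 (int h) = - int h" "window 0 (int h + 1) = 1 - int h" using window_wrap[of 0] by auto
  have old: "window 0 x = (if x = int h then - int h else x)" if "t \<in> old_triangles" "x \<in> t" for t x
    using old_triangle_bounds(1,2)[OF that] wH by (auto intro!: window_id)
  have 1: "window 0 ` t = t" if "t \<in> old_triangles" "int h \<notin> t" for t
  proof -
    have "window 0 x = x" if "x \<in> t" for x using old[OF \<open>t \<in> old_triangles\<close> that] that \<open>int h \<notin> t\<close> by auto
    then show ?thesis by (metis (no_types, lifting) image_cong image_ident)
  qed
  have 2: "window 0 ` t = insert (- int h) (t - {int h})" if t: "t \<in> old_triangles" "int h \<in> t" for t
  proof -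
    have "window 0 ` (t - {int h}) = (\<lambda>x. x) ` (t - {int h})" using old[OF t(1)] by (intro image_cong) auto
    moreover have "insert (int h) (t - {int h}) = t" using t(2) by auto
    ultimately show ?thesis using wH by (metis image_insert image_ident)
  qed
  have split: "old_triangles = {t \<in> old_triangles. int h \<notin> t} \<union> {t \<in> old_triangles. int h \<in> t}" by auto
  have "(`) (window 0) ` old_triangles = (`) (window 0) ` {t \<in> old_triangles. int h \<notin> t} \<union>
      (`) (window 0) ` {t \<in> old_triangles. int h \<in> t}"
    by (subst split) (rule image_Un)
  also have "(`) (window 0) ` {t \<in> old_triangles. int h \<notin> t} = (\<lambda>t. t) ` {t \<in> old_triangles. int h \<notin> t}"
    using 1 by (intro image_cong) auto
  also have "(`) (window 0) ` {t \<in> old_triangles. int h \<in> t} =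
      (\<lambda>t. insert (- int h) (t - {int h})) ` {t \<in> old_triangles. int h \<in> t}"
    using 2 by (intro image_cong) auto
  finally have old': "(`) (window 0) ` old_triangles = {t \<in> old_triangles. int h \<notin> t} \<union>
      (\<lambda>t. insert (- int h) (t - {int h})) ` {t \<in> old_triangles. int h \<in> t}"
    by simp
  have "fan_triangles 0 = {{1, int h, int h + 1}, {- 1, int h - 1, int h}}" by (auto simp: fan_triangles_def)
  then have "(`) (window 0) ` fan_triangles 0 = {{1, - int h, 1 - int h}, {- 1, int h - 1, - int h}}"
    using h2 wH by (simp add: window_id)
  then show ?thesis unfolding link_triangles_def image_Un old' by (simp only: Un_ac)
qed

end

section \<open>Passing from one vertex link to the next\<close>

text \<open>A longest injective path from \<open>p\<close> that meets \<open>q\<close> at most at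
  its end must end at \<open>q\<close>. Otherwise its last vertex has a neighbour other than the
  preceding one, and this neighbour is new: \<open>p\<close> has degree one, and interior vertices
  already have both neighbours on the path.\<close>

lemma path_between:
  fixes R :: "'a \<Rightarrow> 'a \<Rightarrow> bool"
  assumes fin: "finite {y. \<exists>z. R y z}" and sym: "\<And>y z. R y z \<Longrightarrow> R z y" and irr: "\<And>y. \<not> R y y"
    and p: "\<And>z. R p z \<longleftrightarrow> z = p'" and pq: "p \<noteq> q"
    and deg: "\<And>y x. y \<noteq> p \<Longrightarrow> y \<noteq> q \<Longrightarrow> R y x \<Longrightarrow> \<exists>z. z \<noteq> x \<and> (\<forall>u. R y u \<longleftrightarrow> u = x \<or> u = z)"
  obtains b r where "b 0 = p" "b r = q" "0 < r" "inj_on b {..r}" "\<And>i. i < r \<Longrightarrow> R (b i) (b (Suc i))"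
    "\<And>i u. 0 < i \<Longrightarrow> i < r \<Longrightarrow> R (b i) u \<Longrightarrow> u = b (i - 1) \<or> u = b (Suc i)"
proof -
  define good where "good r b \<longleftrightarrow> b 0 = p \<and> inj_on b {..r} \<and> (\<forall>i<r. R (b i) (b (Suc i))) \<and> (\<forall>i<r. b i \<noteq> q)"
    for r and b :: "nat \<Rightarrow> 'a"
  define V where "V = {y. \<exists>z. R y z}"
  have nbr: "u = b (i - 1) \<or> u = b (Suc i)" if g: "good r b" and i: "0 < i" "i < r" and u: "R (b i) u" for r b i u
  proof -
    have 1: "b i \<noteq> p" "b i \<noteq> q" "b (i - 1) \<noteq> b (Suc i)"
      using g i by (auto simp: good_def dest: inj_onD)
    have "R (b (i - 1)) (b (Suc (i - 1)))" using g i unfolding good_def by (metis less_imp_diff_less)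
    then have 2: "R (b i) (b (i - 1))" "R (b i) (b (Suc i))" using g i sym by (auto simp: good_def)
    obtain z where z: "\<And>u. R (b i) u \<longleftrightarrow> u = b (i - 1) \<or> u = z" using deg[OF 1(1,2) 2(1)] by blast
    then have "z = b (Suc i)" using 1 2 by auto
    then show ?thesis using z u by auto
  qed
  have bound: "r < Suc (card V)" if g: "good r b" for r b
  proof -
    have "b i \<in> V" if "i \<le> r" for i
    proof (cases i)
      case 0
      then show ?thesis using g p by (auto simp: V_def good_def)
    next
      case (Suc j)
      then have "R (b j) (b i)" using g that by (auto simp: good_def)
      then show ?thesis using sym by (auto simp: V_def)
    qed
    then have "b ` {..r} \<subseteq> V" by auto
    moreover have "card (b ` {..r}) = Suc r" using g by (simp add: good_def card_image)
    ultimately show ?thesis using card_mono[of V "b ` {..r}"] fin by (simp add: V_def)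
  qed
  have good0: "\<exists>b. good 0 b" by (rule exI[of _ "\<lambda>_. p"]) (simp add: good_def)
  \<comment> \<open>Injectivity bounds the length by the number of vertices, so a greatest length
    exists.\<close>
  obtain r where r: "\<exists>b. good r b" and rmax: "\<And>r'. \<exists>b. good r' b \<Longrightarrow> r' \<le> r"
    using GreatestI_ex_nat[of "\<lambda>r. \<exists>b. good r b" "Suc (card V)"] Greatest_le_nat[of "\<lambda>r. \<exists>b. good r b" _ "Suc (card V)"]
      bound good0 by (metis less_imp_le)
  then obtain b where g: "good r b" by blast
  have "b r = q"
  proof (rule ccontr)
    assume nq: "b r \<noteq> q"
    have "\<exists>z. R (b r) z \<and> z \<notin> b ` {..r}"
    proof (cases "r = 0")
      case True
      then show ?thesis using g p irr by (auto simp: good_def)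
    next
      case False
      then have r0: "0 < r" by simp
      have np: "b r \<noteq> p" using g r0 by (auto simp: good_def dest: inj_onD)
      have "R (b (r - 1)) (b (Suc (r - 1)))" using g r0 unfolding good_def by (metis diff_less zero_less_one)
      then have "R (b r) (b (r - 1))" using r0 sym by simp
      then obtain z where z: "z \<noteq> b (r - 1)" "R (b r) z" using deg[OF np nq] by blast
      have "z \<notin> b ` {..r}"
      proof
        assume "z \<in> b ` {..r}"
        then obtain i where i: "i \<le> r" "z = b i" by auto
        \<comment> \<open>A return to the path would be a loop, a second edge at \<open>p\<close>,
          or a third edge at an interior vertex, unless it goes back to
          \<open>b (r - 1)\<close>.\<close>
        consider "i = r" | "i = 0" "i < r" | "0 < i" "i < r" using i by linarith
        then show False
        proof cases
          case 1
          then show False using z i irr by auto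
        next
          case 2
          then have "R p (b r)" using i z sym g by (auto simp: good_def)
          moreover have "R p (b 1)" using g r0 by (auto simp: good_def)
          ultimately have "b r = b 1" using p by simp
          then have "r = 1" using g r0 by (auto simp: good_def dest: inj_onD)
          then show False using 2 i z by simp
        next
          case 3
          then have "b r = b (i - 1) \<or> b r = b (Suc i)" using nbr[OF g 3] z i sym by blast
          then have "r = i - 1 \<or> r = Suc i" using g 3 by (auto simp: good_def dest: inj_onD)
          then show False using 3 z i by auto
        qed
      qed
      then show ?thesis using z by blast
    qed
    then obtain z where z: "R (b r) z" "z \<notin> b ` {..r}" by blast
    have "good (Suc r) (b(Suc r := z))"
      using g z nq unfolding good_def
      by (auto simp: less_Suc_eq atMost_Suc inj_on_def)
    then show False using rmax by fastforce
  qed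
  moreover have "0 < r" using \<open>b r = q\<close> g pq by (cases r) (auto simp: good_def)
  moreover have "b 0 = p" "inj_on b {..r}" "\<And>i. i < r \<Longrightarrow> R (b i) (b (Suc i))"
    using g by (auto simp: good_def)
  ultimately show ?thesis using nbr[OF g] that by blast
qed

context short_cyclic_family begin

context
  assumes sph0: "is_triangulated_sphere (link_triangles 0)"
begin

text \<open>For \<open>k = 0\<close> the vertices \<open>h\<close> and \<open>-h\<close> coincide; these are the edges of the link of \<open>-h\<close> that move to
  \<open>h\<close> in the splitting, and they turn out to form a path from \<open>-1\<close> to \<open>1\<close>.\<close>

definition upper_edge :: "int \<Rightarrow> int \<Rightarrow> bool" where
  "upper_edge y z \<longleftrightarrow> {int h, y, z} \<in> old_triangles \<or> {y, z} = {- 1, int h - 1}"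

lemma card_link_0: "t \<in> link_triangles 0 \<Longrightarrow> card t = 3"
  by (rule link_triangles_facts)

text \<open>Three positive entries do not fit into \<open>h = 2\<close>, so no \<open>d_i\<close>
  would exist and the link would be a single triangle, whose edges lie in no second one.\<close>

lemma h_ge_3: "h \<ge> 3"
proof (rule ccontr)
  assume "\<not> ?thesis"
  then have h: "h = 2" using h2 by simp
  have "i \<notin> {1..m}" for i
  proof
    assume i: "i \<in> {1..m}"
    have "0 < d i 0" "0 < d i 1" "0 < d i 2" using dpos[OF i] by auto
    then show False using short[OF i] h by simp
  qed
  then have "old_triangles = {}" unfolding old_triangles_def by blast
  moreover have "int h = 2" using h by simp
  ultimately have L: "link_triangles 0 = {{1, - 2, - 1}}"
    unfolding link_triangles_0 by (simp add: insert_commute)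
  then have tri: "{1, - 2, - 1} \<in> link_triangles 0" by simp
  obtain z where z: "z \<noteq> - 1" "{1, - 2, z} \<in> link_triangles 0"
    using triangulated_sphere_edge_in_second_triangle[OF sph0 card_link_0 tri] by blast
  then have "{1, - 2, z} = {1, - 2, - 1 :: int}" using L by simp
  then have "- 1 \<in> {1, - 2, z}" by blast
  then show False using z(1) by simp
qed

lemma upper_edge_sym: "upper_edge y z \<longleftrightarrow> upper_edge z y"
  by (simp add: upper_edge_def insert_commute)

lemma upper_edge_range: "upper_edge y z \<Longrightarrow> y = - 1 \<or> 1 \<le> y \<and> y < int h"
proof -
  assume "upper_edge y z"
  then consider "{int h, y, z} \<in> old_triangles" | "{y, z} = {- 1, int h - 1}" by (auto simp: upper_edge_def)
  then show ?thesis
  proof cases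
    case 1
    have "0 < y" "y \<le> int h" using old_triangle_bounds(2,4)[OF 1, of y] by auto
    moreover have "y \<noteq> int h" using card_3_distinct[OF old_triangle_facts(1)[OF 1]] by simp
    ultimately show ?thesis by simp
  next
    case 2
    then have "y \<in> {- 1, int h - 1}" by blast
    then show ?thesis using h_ge_3 by auto
  qed
qed

lemma upper_edge_irrefl: "\<not> upper_edge y y"
proof
  assume "upper_edge y y"
  then consider "{int h, y, y} \<in> old_triangles" | "{y} = {- 1, int h - 1}" by (auto simp: upper_edge_def)
  then show False
  proof cases
    case 1
    then show False using card_3_distinct[OF old_triangle_facts(1)[OF 1]] by simp
  next
    case 2
    then have "- 1 = int h - 1" by (metis insert_iff singletonD)
    then show False using h_ge_3 by simp
  qed
qed

text \<open>Old triangles at \<open>h\<close> are positive, so only the fan triangle contributes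
  here: \<open>-1\<close> has degree one and can start the path.\<close>

lemma upper_edge_minus_1: "upper_edge (- 1) z \<longleftrightarrow> z = int h - 1"
proof -
  have "{int h, - 1, z} \<notin> old_triangles" using old_triangle_bounds(4)[of "{int h, - 1, z}" "- 1"] by auto
  then show ?thesis by (auto simp: upper_edge_def doubleton_eq_iff)
qed

lemma upper_edge_link: "upper_edge y z \<Longrightarrow> {- int h, y, z} \<in> link_triangles 0"
proof -
  assume "upper_edge y z"
  then consider "{int h, y, z} \<in> old_triangles" | "{y, z} = {- 1, int h - 1}" by (auto simp: upper_edge_def)
  then show ?thesis
  proof cases
    case 1
    have "{int h, y, z} - {int h} = {y, z}" using card_3_distinct[OF old_triangle_facts(1)[OF 1]] by auto
    then have "{- int h, y, z} = insert (- int h) ({int h, y, z} - {int h})" by simp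
    then show ?thesis unfolding link_triangles_0 using 1 by blast
  next
    case 2
    then have "{- int h, y, z} = {- 1, int h - 1, - int h}" by (auto simp: insert_commute)
    then show ?thesis unfolding link_triangles_0 by simp
  qed
qed

text \<open>Edges in the link of the merged vertex come from \<open>h\<close> (upper edges), from
  old triangles at \<open>-h\<close> (both ends negative), or from the fan triangle joining
  \<open>1\<close> to \<open>1 - h\<close>. The latter and the upper edge at \<open>-1\<close> are
  the only crossings between positive and negative vertices.\<close>

lemma link_0_cases:
  assumes t: "{- int h, y, z} \<in> link_triangles 0"
  shows "upper_edge y z \<or> (y < 0 \<and> z < 0) \<or> {y, z} = {1, 1 - int h}"
proof -
  have ne: "y \<noteq> - int h" "z \<noteq> - int h" using card_3_distinct[OF card_link_0[OF t]] by auto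
  have cancel: "A = {y, z}" if "{- int h, y, z} = insert (- int h) A" "- int h \<notin> A" for A
    using that ne by (metis insert_ident insert_iff singletonD)
  from t[unfolded link_triangles_0] consider "{- int h, y, z} \<in> old_triangles"
    | "{- int h, y, z} = {1, - int h, 1 - int h}" | "{- int h, y, z} = {- 1, int h - 1, - int h}"
    | u where "u \<in> old_triangles" "int h \<in> u" "{- int h, y, z} = insert (- int h) (u - {int h})"
    by auto
  then show ?thesis
  proof cases
    case 1
    then show ?thesis using old_triangle_bounds(3)[OF 1] by auto
  next
    case 2
    then have "{- int h, y, z} = insert (- int h) {1, 1 - int h}" by (simp add: insert_commute)
    then show ?thesis using cancel[of "{1, 1 - int h}"] h_ge_3 by auto
  next
    case 3
    then have "{- int h, y, z} = insert (- int h) {- 1, int h - 1}" by (simp add: insert_commute)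
    then have "{- 1, int h - 1} = {y, z}" using cancel[of "{- 1, int h - 1}"] h_ge_3 by auto
    then show ?thesis by (simp add: upper_edge_def)
  next
    case (4 u)
    have "- int h \<notin> u" using old_triangle_bounds(4)[OF 4(1,2), of "- int h"] by auto
    then have "u - {int h} = {y, z}" using cancel[of "u - {int h}"] 4 by auto
    then have "u = {int h, y, z}" using 4(2) by auto
    then show ?thesis using 4(1) by (simp add: upper_edge_def)
  qed
qed

lemma link_0_degree:
  assumes "{- int h, y, x} \<in> link_triangles 0"
  obtains z where "z \<noteq> x" "\<And>u. {- int h, y, u} \<in> link_triangles 0 \<longleftrightarrow> u = x \<or> u = z"
  using triangulated_sphere_edge_degree[OF sph0 card_link_0 assms] by blast

text \<open>Vertices of upper edges other than \<open>1\<close> and \<open>-1\<close> have degree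
  two by the sphere condition, which yields a path from \<open>-1\<close> to \<open>1\<close>.
  Connectedness of the whole link then rules out further components made of upper edges.\<close>

lemma upper_path:
  obtains b r where "b 0 = - 1" "b r = 1" "2 \<le> r" "inj_on b {..r}"
    "\<And>y z. upper_edge y z \<longleftrightarrow> (\<exists>i<r. {y, z} = {b i, b (Suc i)})"
    "\<And>i. 0 < i \<Longrightarrow> i \<le> r \<Longrightarrow> 1 \<le> b i \<and> b i < int h" "\<And>i. i < r \<Longrightarrow> b i \<noteq> 1"
proof -
  \<comment> \<open>Here \<open>y\<close> lies between \<open>2\<close> and \<open>h - 1\<close>;
    every link edge at such a vertex is an upper edge, so the degree in the link is the degree in
    the upper graph.\<close>
  have deg: "\<exists>z. z \<noteq> x \<and> (\<forall>u. upper_edge y u \<longleftrightarrow> u = x \<or> u = z)"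
    if y: "y \<noteq> - 1" "y \<noteq> 1" "upper_edge y x" for y x
  proof -
    have y1: "1 \<le> y" "y < int h" using upper_edge_range[OF y(3)] y(1) by auto
    have "upper_edge y u \<longleftrightarrow> {- int h, y, u} \<in> link_triangles 0" for u
      using link_0_cases[of y u] upper_edge_link[of y u] y1 y(2) by (auto simp: doubleton_eq_iff)
    then show ?thesis using link_0_degree[OF upper_edge_link[OF y(3)]] by metis
  qed
  have "{y. \<exists>z. upper_edge y z} \<subseteq> {- 1..int h}" using upper_edge_range by fastforce
  then have fin: "finite {y. \<exists>z. upper_edge y z}" by (rule finite_subset) simp
  obtain b r where b0: "b 0 = - 1" and br: "b r = 1" and r0: "0 < r" and inj: "inj_on b {..r}"
    and edge: "\<And>i. i < r \<Longrightarrow> upper_edge (b i) (b (Suc i))"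
    and nbr: "\<And>i u. 0 < i \<Longrightarrow> i < r \<Longrightarrow> upper_edge (b i) u \<Longrightarrow> u = b (i - 1) \<or> u = b (Suc i)"
    using path_between[OF fin upper_edge_sym[THEN iffD1] upper_edge_irrefl upper_edge_minus_1 _ deg, of 1]
    by auto
  have r2: "2 \<le> r"
  proof (rule ccontr)
    assume "\<not> ?thesis"
    then have "r = 1" using r0 by simp
    then have "upper_edge (- 1) 1" using edge[of 0] b0 br by simp
    then show False using upper_edge_minus_1 h_ge_3 by simp
  qed
  have bpos: "1 \<le> b i \<and> b i < int h" if "0 < i" "i \<le> r" for i
  proof -
    have "upper_edge (b (i - 1)) (b (Suc (i - 1)))" using that by (intro edge) simp
    then have "upper_edge (b i) (b (i - 1))" using that upper_edge_sym by simp
    moreover have "b i \<noteq> - 1" using inj b0 that by (metis atMost_iff inj_onD le0 less_numeral_extra(3))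
    ultimately show ?thesis using upper_edge_range by blast
  qed
  have bone: "b i \<noteq> 1" if "i < r" for i
    using inj br that by (metis atMost_iff inj_onD less_imp_le_nat order_refl less_irrefl)
  have last: "upper_edge 1 (b (r - 1))" using edge[of "r - 1"] r0 br upper_edge_sym by simp
  \<comment> \<open>This edge takes one of the two places at the vertex \<open>1\<close>, so only
    one upper edge is left there, the last one of the path.\<close>
  have low: "{- int h, 1, 1 - int h} \<in> link_triangles 0"
    unfolding link_triangles_0 by (simp add: insert_commute)
  have at_path: "\<exists>i<r. {b j, z} = {b i, b (Suc i)}" if j: "j \<le> r" and e: "upper_edge (b j) z" for j z
  proof -
    consider "j = 0" | "0 < j" "j < r" | "j = r" using j by linarith
    then show ?thesis
    proof cases
      case 1
      then have "z = int h - 1" "b 1 = int h - 1"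
        using e b0 edge[of 0] r0 upper_edge_minus_1 by auto
      then show ?thesis using 1 r0 by auto
    next
      case 2
      then consider "z = b (j - 1)" | "z = b (Suc j)" using nbr e by blast
      then show ?thesis
      proof cases
        case 1
        then show ?thesis using 2 by (intro exI[of _ "j - 1"]) (auto simp: insert_commute)
      qed (use 2 in auto)
    next
      case 3
      then have e1: "upper_edge 1 z" using e br by simp
      have zl: "z \<noteq> 1 - int h" "b (r - 1) \<noteq> 1 - int h"
        using upper_edge_range[of z 1] upper_edge_range[of "b (r - 1)" 1] e1 last upper_edge_sym h_ge_3 by auto
      have "z = b (r - 1)"
        using triangulated_sphere_edge_not_in_three_triangles[OF sph0 card_link_0 low
            upper_edge_link[OF last] upper_edge_link[OF e1]] zl by auto
      then show ?thesis using 3 r0 br by (intro exI[of _ "r - 1"]) (auto simp: insert_commute)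
    qed
  qed
  \<comment> \<open>Including all negative vertices makes \<open>P\<close> closed: the circle leaves
    the path only through its ends, and does so into the negative vertices. The only negative vertex
    on an upper edge is \<open>-1\<close>, which is on the path.\<close>
  define P where "P = b ` {..r} \<union> {y. y < 0}"
  have closed: "z \<in> P" if yz: "{- int h, y, z} \<in> link_triangles 0" "y \<in> P" for y z
  proof -
    consider "upper_edge y z" | "z < 0" | "{y, z} = {1, 1 - int h}" using link_0_cases[OF yz(1)] by blast
    then show ?thesis
    proof cases
      case 1
      have "y \<in> b ` {..r}"
      proof (cases "y < 0")
        case True
        then have "y = b 0" using upper_edge_range[OF 1] b0 by auto
        then show ?thesis by blast
      qed (use yz(2) P_def in auto)
      then obtain j where "j \<le> r" "y = b j" by auto
      then obtain i where "i < r" "{y, z} = {b i, b (Suc i)}" using at_path 1 by blast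
      then have "z \<in> {b i, b (Suc i)}" "i \<le> r" "Suc i \<le> r" by auto
      then show ?thesis unfolding P_def by auto
    next
      case 3
      then have "z \<in> {1, 1 - int h}" by blast
      then have "z = b r \<or> z < 0" using br h_ge_3 by auto
      then show ?thesis unfolding P_def by auto
    qed (simp add: P_def)
  qed
  have 1: "1 \<in> P" unfolding P_def using br by (metis UnI1 atMost_iff imageI order_refl)
  have "upper_edge y z \<longleftrightarrow> (\<exists>i<r. {y, z} = {b i, b (Suc i)})" for y z
  proof
    assume e: "upper_edge y z"
    have "y \<in> P"
      by (rule triangulated_sphere_link_connected[OF sph0 card_link_0 closed low 1 upper_edge_link[OF e]])
    then have "y \<in> b ` {..r} \<or> y = b 0" using upper_edge_range[OF e] b0 by (auto simp: P_def)
    then obtain j where "j \<le> r" "y = b j" by auto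
    then show "\<exists>i<r. {y, z} = {b i, b (Suc i)}" using at_path e by blast
  next
    assume "\<exists>i<r. {y, z} = {b i, b (Suc i)}"
    then obtain i where "i < r" "{y, z} = {b i, b (Suc i)}" by auto
    then show "upper_edge y z" using edge[of i] upper_edge_sym by (auto simp: doubleton_eq_iff)
  qed
  then show ?thesis using that[OF b0 br r2 inj] bpos bone by blast
qed

text \<open>This is the vertex split with \<open>w = -h\<close> and \<open>v = h\<close>. The fan
  consists of the triangles over the upper edges, which move to \<open>h\<close>; \<open>R\<close>
  collects the triangles that are unaffected.\<close>

lemma homeomorphic_link_0_1:
  "geom_realization (faces (link_triangles 0)) homeomorphic geom_realization (faces (link_triangles 1))"
proof -
  obtain b r where b0: "b 0 = - 1" and br: "b r = 1" and r2: "2 \<le> r" and inj: "inj_on b {..r}"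
    and edges: "\<And>y z. upper_edge y z \<longleftrightarrow> (\<exists>i<r. {y, z} = {b i, b (Suc i)})"
    and bpos: "\<And>i. 0 < i \<Longrightarrow> i \<le> r \<Longrightarrow> 1 \<le> b i \<and> b i < int h" and bone: "\<And>i. i < r \<Longrightarrow> b i \<noteq> 1"
    using upper_path by blast
  define R where "R = {t \<in> old_triangles. int h \<notin> t} \<union> {{1, - int h, 1 - int h}}"
  have edge: "upper_edge (b i) (b (Suc i))" if "i < r" for i using edges that by blast
  have split: "\<exists>y z. t = {int h, y, z} \<and> upper_edge y z \<and> t - {int h} = {y, z}"
    if t: "t \<in> old_triangles" "int h \<in> t" for t
  proof -
    have "card (t - {int h}) = 2" using old_triangle_facts(1)[OF t(1)] t(2) by simp
    then obtain y z where yz: "t - {int h} = {y, z}" by (auto simp: card_2_iff)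
    then have "t = {int h, y, z}" using t(2) by auto
    then show ?thesis using t yz by (auto simp: upper_edge_def)
  qed
  have L0: "link_triangles 0 = R \<union> {{- int h, b i, b (Suc i)} | i. i < r}"
  proof (intro equalityI subsetI)
    fix t assume "t \<in> link_triangles 0"
    then consider "t \<in> R" | "t = {- 1, int h - 1, - int h}"
      | u where "u \<in> old_triangles" "int h \<in> u" "t = insert (- int h) (u - {int h})"
      unfolding link_triangles_0 R_def by auto
    then have "t \<in> R \<or> (\<exists>y z. upper_edge y z \<and> t = {- int h, y, z})"
    proof cases
      case 2
      then have "t = {- int h, - 1, int h - 1}" by (simp add: insert_commute)
      then show ?thesis using upper_edge_minus_1 by blast
    next
      case (3 u)
      then show ?thesis using split[OF 3(1,2)] by auto
    qed simp
    then show "t \<in> R \<union> {{- int h, b i, b (Suc i)} | i. i < r}" using edges by fastforce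
  next
    fix t assume "t \<in> R \<union> {{- int h, b i, b (Suc i)} | i. i < r}"
    then show "t \<in> link_triangles 0"
    proof
      assume "t \<in> R"
      then show ?thesis unfolding link_triangles_0 R_def by blast
    qed (use upper_edge_link[OF edge] in auto)
  qed
  have L1: "link_triangles 1 = R \<union> {{int h, b i, b (Suc i)} | i. i < r} \<union> {{int h, - int h, b 0}, {int h, - int h, b r}}"
  proof (intro equalityI subsetI)
    fix t assume "t \<in> link_triangles 1"
    then consider "t \<in> base_triangles" | "t = {1, int h, - int h}" | "t = {- 1, int h, - int h}"
      unfolding One_nat_def link_triangles_Suc by auto
    then consider "t \<in> R" | y z where "upper_edge y z" "t = {int h, y, z}" | "t = {int h, - int h, b 0}" | "t = {int h, - int h, b r}"
    proof cases
      case 1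
      then consider "t \<in> old_triangles" "int h \<notin> t" | "t \<in> old_triangles" "int h \<in> t"
        | "t = {1, - int h, 1 - int h}" | "t = {int h, - 1, int h - 1}"
        by (auto simp: base_triangles_def insert_commute)
      then show thesis
      proof cases
        case 2
        then show thesis using split that(2) by blast
      next
        case 4
        then show thesis using that(2)[of "- 1" "int h - 1"] upper_edge_minus_1 by simp
      qed (use that(1) in \<open>auto simp: R_def\<close>)
    qed (use that(3,4) b0 br in \<open>auto simp: insert_commute\<close>)
    then show "t \<in> R \<union> {{int h, b i, b (Suc i)} | i. i < r} \<union> {{int h, - int h, b 0}, {int h, - int h, b r}}"
    proof cases
      case (2 y z)
      then obtain i where "i < r" "{y, z} = {b i, b (Suc i)}" using edges by blast
      then show ?thesis using 2(2) by blast
    qed simp_all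
  next
    fix t assume "t \<in> R \<union> {{int h, b i, b (Suc i)} | i. i < r} \<union> {{int h, - int h, b 0}, {int h, - int h, b r}}"
    then consider "t \<in> R" | i where "i < r" "t = {int h, b i, b (Suc i)}" | "t = {- 1, int h, - int h}" | "t = {1, int h, - int h}"
      using b0 br by (auto simp: insert_commute)
    then have "t \<in> base_triangles \<or> t \<in> {{x, int h, - int h} | x. x \<in> {1, - 1}}"
    proof cases
      case 1
      then show ?thesis by (auto simp: R_def base_triangles_def)
    next
      case (2 i)
      then have "t \<in> old_triangles \<or> t = {- 1, int h - 1, int h}"
        using edge[OF 2(1)] unfolding upper_edge_def by (auto simp: insert_commute)
      then show ?thesis by (auto simp: base_triangles_def)
    qed auto
    then show "t \<in> link_triangles 1" unfolding One_nat_def link_triangles_Suc by auto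
  qed
  have brange: "b i = - 1 \<or> 1 \<le> b i \<and> b i < int h" if "i \<le> r" for i
    using bpos[of i] b0 that by (cases "i = 0") auto
  show ?thesis
    unfolding L0 L1
  proof (rule homeomorphic_vertex_split[OF r2 inj])
    show "- int h \<notin> b ` {..r}" "int h \<notin> b ` {..r}" using brange h_ge_3 by fastforce+
    show "int h \<noteq> - int h" using h_ge_3 by simp
    show "finite t \<and> int h \<notin> t" if "t \<in> R" for t
      using that old_triangle_facts(2) h_ge_3 by (auto simp: R_def)
    \<comment> \<open>Interior path vertices are at least \<open>2\<close>, whereas triangles of
      \<open>R\<close> at \<open>-h\<close> contain no positive vertex except possibly
      \<open>1\<close>.\<close>
    show "b i \<notin> t" if t: "t \<in> R" "- int h \<in> t" and i: "0 < i" "i < r" for t i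
    proof -
      have bi: "1 \<le> b i" "b i \<noteq> 1" using bpos[of i] bone[of i] i by auto
      from t(1) consider "t \<in> old_triangles" | "t = {1, - int h, 1 - int h}" by (auto simp: R_def)
      then show ?thesis
      proof cases
        case 1
        then show ?thesis using old_triangle_bounds(3)[OF 1 t(2), of "b i"] bi by auto
      qed (use bi h_ge_3 in auto)
    qed
  qed
qed

lemma link_sphere: "is_triangulated_sphere (link_triangles k)"
proof (induction k)
  case 0
  show ?case by (rule sph0)
next
  case (Suc k)
  have "geom_realization (faces (link_triangles k)) homeomorphic geom_realization (faces (link_triangles (Suc k)))"
    using homeomorphic_link_0_1 homeomorphic_link_Suc by (cases k) simp_all
  then show ?case by (rule homeomorphic_trans[OF homeomorphic_sym[THEN iffD1] Suc])
qed

end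

section \<open>Neighbourliness read off from the vertex link\<close>

text \<open>The vertices occurring in \<open>quad\<close> are all differences of distinct partial
  sums, a set symmetric under negation.\<close>

lemma old_triangles_uminus: "x \<in> \<Union>old_triangles \<Longrightarrow> - x \<in> \<Union>old_triangles"
proof -
  assume "x \<in> \<Union>old_triangles"
  then obtain i where i: "i \<in> {1..m}" "x \<in> \<Union>(quad (int (d i 0)) (int (d i 1)) (int (d i 2)))"
    unfolding old_triangles_def by blast
  have "- x \<in> \<Union>(quad a b c)" if "x \<in> \<Union>(quad a b c)" for a b c
    using that unfolding quad_def by auto
  then show ?thesis using i unfolding old_triangles_def by blast
qed

lemma Union_link_triangles:
  "\<Union>(link_triangles k) = window k ` (\<Union>old_triangles \<union> {1, - 1} \<union> {int h - 1..int h + int k + 1})"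
proof -
  have "\<Union>(fan_triangles k) = {1, - 1} \<union> {int h - 1..int h + int k + 1}"
  proof (intro equalityI subsetI)
    fix x assume "x \<in> {1, - 1} \<union> {int h - 1..int h + int k + 1}"
    then consider "x = 1 \<or> x = - 1" | "x = int h - 1" | "x = int h + int k + 1" | "x \<in> {int h..int h + int k}"
      by fastforce
    moreover have mem: "x \<in> \<Union>(fan_triangles k)"
      if "j \<in> {int h..int h + int k}" "x \<in> {1, j, j + 1} \<or> x \<in> {- 1, j - 1, j}" for j
      using that unfolding fan_triangles_def by blast
    ultimately show "x \<in> \<Union>(fan_triangles k)"
      by cases (use mem[of "int h"] mem[of "int h + int k"] mem[of x] in auto)
  qed (auto simp: fan_triangles_def)
  then show ?thesis
    unfolding link_triangles_def by (simp only: image_Union[symmetric] Union_Un_distrib Un_assoc)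
qed

text \<open>Whether \<open>{u, v}\<close> is an edge depends only on \<open>v - u\<close> modulo
  \<open>n + k\<close>, whose representative in the window must be a vertex of the link.\<close>

lemma neighbourly_iff_Union_link:
  "neighbourly (ext_cplx n m d k) \<longleftrightarrow> {- int h..<int h + int k} - {0} \<subseteq> \<Union>(link_triangles k)"
proof -
  let ?K = "ext_cplx n m d k"
  have edge: "{u, v} \<in> ?K \<longleftrightarrow> window k (int v - int u) \<in> \<Union>(link_triangles k)"
    if uv: "u < n + k" "v < n + k" "u \<noteq> v" for u v
  proof -
    have "{u, v} \<in> ?K \<longleftrightarrow> {v} \<in> cplx_link ?K u"
      using uv by (auto simp: cplx_link_def ext_cplx_eq faces_def)
    also have "\<dots> \<longleftrightarrow> (\<exists>z\<in>\<Union>(link_triangles k). residue (n + k) u z = v)"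
      unfolding link_ext_cplx[OF uv(1)] by (auto simp: faces_def)
    also have "\<dots> \<longleftrightarrow> window k (int v - int u) \<in> \<Union>(link_triangles k)"
    proof -
      have v: "residue (n + k) u (window k (int v - int u)) = v"
        unfolding residue_window using uv(2) by (simp add: residue_def)
      have "z = window k (int v - int u)" if z: "z \<in> \<Union>(link_triangles k)" "residue (n + k) u z = v" for z
      proof -
        have "inj_on (residue (n + k) u) {- int h..<int h + int k}"
          by (rule inj_on_residue) (use n in auto)
        moreover have "z \<in> {- int h..<int h + int k}" using z(1) link_triangles_facts(2) by blast
        moreover have "window k (int v - int u) \<in> {- int h..<int h + int k}" using window_range by auto
        ultimately show ?thesis using z(2) v by (metis inj_onD)
      qed
      then show ?thesis using v by (metis (no_types, lifting))
    qed
    finally show ?thesis .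
  qed
  have w0: "window k (int v - int u) \<in> {- int h..<int h + int k} - {0}"
    if uv: "u < n + k" "v < n + k" "u \<noteq> v" for u v
  proof -
    have "window k (int v - int u) \<noteq> 0"
    proof
      assume "window k (int v - int u) = 0"
      then have "residue (n + k) u (int v - int u) = residue (n + k) u 0" by (metis residue_window)
      then show False using uv by (simp add: residue_def)
    qed
    then show ?thesis using window_range by auto
  qed
  show ?thesis
  proof
    assume nb: "neighbourly ?K"
    show "{- int h..<int h + int k} - {0} \<subseteq> \<Union>(link_triangles k)"
    proof
      fix z assume z: "z \<in> {- int h..<int h + int k} - {0}"
      \<comment> \<open>One of the two is 0, and their difference is \<open>z\<close>.\<close>
      define u v where "u = nat (- z)" and "v = nat z"
      have uv: "u < n + k" "v < n + k" "u \<noteq> v" "int v - int u = z" using z n h2 by (auto simp: u_def v_def)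
      then have "{u, v} \<in> ?K" using nb unfolding neighbourly_def vertices_ext_cplx by auto
      then show "z \<in> \<Union>(link_triangles k)" using edge[OF uv(1-3)] uv(4) z by (simp add: window_id)
    qed
  next
    assume sub: "{- int h..<int h + int k} - {0} \<subseteq> \<Union>(link_triangles k)"
    show "neighbourly ?K"
      unfolding neighbourly_def vertices_ext_cplx
    proof (intro ballI impI)
      fix u v assume "u \<in> {..<n + k}" "v \<in> {..<n + k}" "u \<noteq> v"
      then show "{u, v} \<in> ?K" using edge[of u v] subsetD[OF sub w0[of u v]] by simp
    qed
  qed
qed

text \<open>The fan covers \<open>1\<close>, \<open>-1\<close> and everything from
  \<open>h - 1\<close> to \<open>h + k + 1\<close>, the top two of which wrap to \<open>-h\<close>
  and \<open>1 - h\<close>. What is missing is \<open>2, ..., h - 2\<close> and the negatives, and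
  by symmetry the positive half suffices. The resulting condition does not mention
  \<open>k\<close>.\<close>

lemma neighbourly_iff:
  "neighbourly (ext_cplx n m d k) \<longleftrightarrow> (\<forall>z\<in>{2..int h - 2}. z \<in> \<Union>old_triangles)"
proof -
  have wrap: "window k x = (if x < int h + int k then x else x - int (n + k))"
    if x: "- int h \<le> x" "x \<le> int h + int k + 1" for x
  proof (cases "x < int h + int k")
    case True
    then show ?thesis using x by (simp add: window_id)
  next
    case False
    then have "x = int h + int k \<or> x = int h + int k + 1" using x by linarith
    then show ?thesis using window_wrap[of k] n by auto
  qed
  define V where "V = \<Union>old_triangles \<union> {1, - 1} \<union> {int h - 1..int h + int k + 1}"
  have V: "- int h \<le> x" "x \<le> int h + int k + 1" if "x \<in> V" for x
    using that old_triangle_bounds(1,2) h2 by (fastforce simp: V_def)+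
  show ?thesis
    unfolding neighbourly_iff_Union_link Union_link_triangles V_def[symmetric]
  proof
    assume sub: "{- int h..<int h + int k} - {0} \<subseteq> window k ` V"
    show "\<forall>z\<in>{2..int h - 2}. z \<in> \<Union>old_triangles"
    proof
      fix z assume z: "z \<in> {2..int h - 2}"
      then have "z \<in> window k ` V" using sub by auto
      then obtain x where x: "x \<in> V" "z = window k x" by auto
      then have "x = z" using V[OF x(1)] wrap[of x] z n by (auto split: if_splits)
      then show "z \<in> \<Union>old_triangles" using x(1) z by (auto simp: V_def)
    qed
  next
    assume all: "\<forall>z\<in>{2..int h - 2}. z \<in> \<Union>old_triangles"
    show "{- int h..<int h + int k} - {0} \<subseteq> window k ` V"
    proof
      fix z assume z: "z \<in> {- int h..<int h + int k} - {0}"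
      consider "z \<in> {2..int h - 2}" | "- z \<in> {2..int h - 2}" | "z = 1 \<or> z = - 1" | "int h - 1 \<le> z"
        | "z = - int h" | "z = 1 - int h"
        using z by fastforce
      then show "z \<in> window k ` V"
      proof cases
        case 5
        then show ?thesis using window_wrap(1)[of k] by (intro image_eqI[of _ _ "int h + int k"]) (auto simp: V_def)
      next
        case 6
        then show ?thesis using window_wrap(2)[of k] by (intro image_eqI[of _ _ "int h + int k + 1"]) (auto simp: V_def)
      next
        case 1
        then show ?thesis using all z by (intro image_eqI[of _ _ z]) (auto simp: V_def window_id)
      next
        case 2
        then have "- (- z) \<in> \<Union>old_triangles" using all old_triangles_uminus by blast
        then show ?thesis using z by (intro image_eqI[of _ _ z]) (auto simp: V_def window_id)
      next
        case 3
        then show ?thesis using z by (intro image_eqI[of _ _ z]) (auto simp: V_def window_id)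
      next
        case 4
        then show ?thesis using z by (intro image_eqI[of _ _ z]) (auto simp: V_def window_id)
      qed
    qed
  qed
qed

end

section \<open>Assembling the equivalences\<close>

lemma pure_cplx_card_vertices:
  assumes "simplicial_cplx K" "pure_cplx e K" "finite (cplx_vertices K)"
  shows "e + 1 \<le> card (cplx_vertices K)"
proof -
  have finK: "finite K" "K \<noteq> {}" using assms by (auto simp: simplicial_cplx_def pure_cplx_def)
  obtain s where s: "s \<in> K" "\<And>t. t \<in> K \<Longrightarrow> s \<subseteq> t \<Longrightarrow> t = s"
    using finite_has_maximal[OF finK] by blast
  then have "card s = e + 1" using assms(2) by (auto simp: pure_cplx_def cplx_facets_def)
  moreover have "card s \<le> card (cplx_vertices K)" using s(1) assms(3) by (intro card_mono) auto
  ultimately show ?thesis by simp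
qed

theorem theorem1p1:
  fixes n m :: nat
    and d :: "nat \<Rightarrow> nat \<Rightarrow> nat"
    and M :: "nat set set"
  assumes "even n" and "n > 0"
    and "\<forall>i\<in>{1..m}. \<forall>j\<le>3. 0 < d i j"
    and "\<forall>i\<in>{1..m}. d i 0 + d i 1 + d i 2 + d i 3 = n"
    and "\<forall>i\<in>{1..m}. \<forall>j\<le>2. d i j \<le> d i 3"
    and "inj_on (\<lambda>i. diff_cycle [d i 0, d i 1, d i 2, d i 3]) {1..m}"
    and "\<forall>i\<in>{1..m}. diff_cycle [d i 0, d i 1, d i 2, d i 3]
           \<noteq> diff_cycle [1, n div 2 - 1, 1, n div 2 - 1]"
    and "M = diff_cplx ((\<lambda>i. [d i 0, d i 1, d i 2, d i 3]) ` {1..m} \<union>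
           {[1, n div 2 - 1, 1, n div 2 - 1]})"
    and "card (cplx_vertices M) = n"
    and "combinatorial_3_manifold M"
  shows "((\<forall>k. combinatorial_3_manifold (ext_cplx n m d k)) \<longleftrightarrow>
            (\<forall>i\<in>{1..m}. \<exists>j\<le>3. n div 2 \<le> d i j))
       \<and> ((\<forall>i\<in>{1..m}. \<exists>j\<le>3. n div 2 \<le> d i j) \<longleftrightarrow>
            (\<forall>i\<in>{1..m}. d i 0 + d i 1 + d i 2 \<le> n div 2))
       \<and> ((\<forall>i\<in>{1..m}. \<exists>j\<le>3. n div 2 \<le> d i j) \<longrightarrow>
            (\<forall>k. neighbourly M \<longleftrightarrow> neighbourly (ext_cplx n m d k)))"
proof -
  define h where "h = n div 2"
  have nh: "n = 2 * h" using assms(1) by (simp add: h_def)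
  have "finite (cplx_vertices M)" using assms(2,9) by (metis card.infinite less_irrefl)
  \<comment> \<open>A tetrahedron has four vertices; this is the source of \<open>h\<close> being at
    least 2.\<close>
  then have "4 \<le> n" using pure_cplx_card_vertices[of M 3] assms(9,10) by (simp add: combinatorial_3_manifold_def)
  then have h2: "2 \<le> h" using nh by simp
  interpret cyclic_family n m h d
    using nh h2 assms(3,4) by unfold_locales auto
  \<comment> \<open>For \<open>k = 0\<close> the only index is \<open>l = h\<close>, which
    identifies \<open>M\<close> with the member \<open>k = 0\<close> of the family.\<close>
  have "{[1, l - 1, 1, n + 0 - l - 1] | l. n div 2 \<le> l \<and> l \<le> (n + 0) div 2} = {[1, h - 1, 1, h - 1]}"
    using nh by (auto simp: h_def[symmetric])
  moreover have "ext_cycle d 0 = (\<lambda>i. [d i 0, d i 1, d i 2, d i 3])" by (simp add: ext_cycle_def fun_eq_iff)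
  ultimately have M: "M = ext_cplx n m d 0"
    unfolding ext_cplx_def assms(8) h_def[symmetric] by simp
  have entry: "(\<exists>j\<le>3. n div 2 \<le> d i j) \<longleftrightarrow> d i 0 + d i 1 + d i 2 \<le> n div 2" if i: "i \<in> {1..m}" for i
  proof -
    have le: "d i j \<le> d i 3" if "j \<le> 3" for j
      using assms(5) i that by (cases "j = 3") auto
    \<comment> \<open>The fourth entry is the largest, so it is the one to be tested, and it is the
      complement of the sum of the other three.\<close>
    have "(\<exists>j\<le>3. n div 2 \<le> d i j) \<longleftrightarrow> n div 2 \<le> d i 3" using le by (meson order_refl order_trans)
    then show ?thesis using dsum[OF i] nh by auto
  qed
  have forward: "d i 0 + d i 1 + d i 2 \<le> h"
    if mf: "combinatorial_3_manifold (ext_cplx n m d n)" and i: "i \<in> {1..m}" for i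
  proof (rule ccontr)
    assume "\<not> ?thesis"
    then have gt: "h < d i 0 + d i 1 + d i 2" by simp
    then have d02: "d i 0 = 1" "d i 2 = 1"
      using long_cycle_in_fan i mf unfolding manifold_iff_link_sphere by blast+
    \<comment> \<open>With both outer entries 1, the assumption \<open>gt\<close> makes
      \<open>d i 1\<close> at least \<open>h - 1\<close>; since \<open>d i 1\<close> and
      \<open>d i 3\<close> add up to \<open>2 h - 2\<close>, maximality of \<open>d i 3\<close>
      leaves only equality.\<close>
    have "d i 1 \<le> d i 3" using assms(5) i by auto
    then have "d i 1 = h - 1" "d i 3 = h - 1" using gt d02 dsum[OF i] nh by auto
    then have "[d i 0, d i 1, d i 2, d i 3] = [1, n div 2 - 1, 1, n div 2 - 1]"
      using d02 by (simp add: h_def)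
    then show False using assms(7) i by metis
  qed
  have short: "short_cyclic_family n m h d" if "\<forall>i\<in>{1..m}. d i 0 + d i 1 + d i 2 \<le> h"
    using that cyclic_family_axioms by (simp add: short_cyclic_family_def short_cyclic_family_axioms_def)
  have backward: "combinatorial_3_manifold (ext_cplx n m d k)"
    if "\<forall>i\<in>{1..m}. d i 0 + d i 1 + d i 2 \<le> h" for k
  proof -
    have "is_triangulated_sphere (link_triangles 0)"
      using assms(10) unfolding M manifold_iff_link_sphere .
    then show ?thesis
      unfolding manifold_iff_link_sphere by (rule short_cyclic_family.link_sphere[OF short[OF that]])
  qed
  have nb: "neighbourly M \<longleftrightarrow> neighbourly (ext_cplx n m d k)"
    if "\<forall>i\<in>{1..m}. d i 0 + d i 1 + d i 2 \<le> h" for k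
    using short_cyclic_family.neighbourly_iff[OF short[OF that]] by (simp add: M)
  have cond: "(\<forall>i\<in>{1..m}. \<exists>j\<le>3. n div 2 \<le> d i j) \<longleftrightarrow> (\<forall>i\<in>{1..m}. d i 0 + d i 1 + d i 2 \<le> n div 2)"
    using entry by auto
  have "(\<forall>k. combinatorial_3_manifold (ext_cplx n m d k)) \<longleftrightarrow> (\<forall>i\<in>{1..m}. d i 0 + d i 1 + d i 2 \<le> h)"
    using forward backward by meson
  then show ?thesis
    using nb cond unfolding h_def[symmetric] by simp
qed

end
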